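(* Let $q$ be a prime power and let $\mathcal{X}=Z(f_{\mathcal{X}})$ be a degenerate quadric in $\mathbb{P}^4(\mathbb{F}_q)$ of rank 4 with projective index $g(\mathcal{X})=1$. For every quadric $\mathcal{Q}=Z(f)$ in $\mathbb{P}^4(\mathbb{F}_q)$, where $f$ is a nonzero form of degree 2 which is not a scalar multiple of $f_{\mathcal{X}}$, one has $$\#(\mathcal{X}\cap\mathcal{Q})(\mathbb{F}_q)\le 3q^2+q+1.$$ Moreover, the code $C_2(\mathcal{X})$ is an $[n,k,d]_q$-code (length $n$, dimension $k$, minimum distance $d$) with $$n=q^3+q+1,\qquad k=14,\qquad d\ge q^3-3q^2.$$
   Context: A quadric in $\mathbb{P}^4(\mathbb{F}_q)$ is the zero set $Z(f)$ of a nonzero form $f$ of degree 2 in $x_0,\dots,x_4$ over $\mathbb{F}_q$. Its rank is the smallest number of indeterminates appearing in $f$ after an invertible linear change of coordinates. The projective index $g(\mathcal{X})$ is the maximum dimension of a linear subspace (over $\mathbb{F}_q$) contained in $\mathcal{X}$. A rank 4 quadric with projective index 1 is a cone with vertex a point over an elliptic quadric of $\mathbb{P}^3(\mathbb{F}_q)$. Functional code: let $\mathcal{F}_2$ be the $\mathbb{F}_q$-vector space of forms of degree 2 in $x_0,\dots,x_4$ (with $0$). The code $C_2(\mathcal{X})$ is the image of the linear map $c:\mathcal{F}_2\to\mathbb{F}_q^{|\mathcal{X}|}$, $c(f)=(c_x(f))_{x\in\mathcal{X}(\mathbb{F}_q)}$, where $c_x(f)=f(x_0,\dots,x_4)/x_i^2$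 for $x=(x_0:\dots:x_4)$ and $i$ the smallest index with $x_i\ne0$. The weight of $c(f)$ is $\#\mathcal{X}(\mathbb{F}_q)-\#(\mathcal{X}\cap Z(f))(\mathbb{F}_q)$; the minimum distance is the smallest weight of a nonzero codeword.
   Formalization: The claim k = 14 is asserted only for q ≠ 2: for q = 2 the length is n = 11, so k ≤ 11 and k = 14 is false; all other claims are asserted for every prime power q. *)

theory Defs
  imports "HOL-Analysis.Analysis" "HOL-Library.Poly_Mapping"
begin

text \<open>
  The finite field is a type \<open>'a :: {field, finite}\<close> with \<open>CARD('a)\<close> elements.  The coordinates of
  \<open>P^4\<close> are indexed by the five-element type \<open>5\<close>, whose elements are \<open>0 < 1 < 2 < 3 < 4\<close>.
\<close>

subsection \<open>Quadratic forms\<close>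

text \<open>Polynomials are formal objects (coefficients indexed by exponent vectors), not functions.\<close>

type_synonym ('a, 'n) polynomial = "('n \<Rightarrow>\<^sub>0 nat) \<Rightarrow>\<^sub>0 'a"

definition monom_degree :: "('n::finite \<Rightarrow>\<^sub>0 nat) \<Rightarrow> nat"
  where "monom_degree m = (\<Sum>i\<in>UNIV. Poly_Mapping.lookup m i)"

definition quadratic_forms :: "('a::field, 'n::finite) polynomial set"
  where "quadratic_forms = {f. \<forall>m\<in>Poly_Mapping.keys f. monom_degree m = 2}"

definition const_poly :: "'a::field \<Rightarrow> ('a, 'n::finite) polynomial"
  where "const_poly c = Poly_Mapping.single 0 c"

definition indet :: "'n::finite \<Rightarrow> ('a::field, 'n) polynomial"
  where "indet i = Poly_Mapping.single (Poly_Mapping.single i 1) 1"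

definition eval_poly :: "('a::field, 'n::finite) polynomial \<Rightarrow> 'a ^ 'n \<Rightarrow> 'a"
  where "eval_poly f v =
    (\<Sum>m\<in>Poly_Mapping.keys f. Poly_Mapping.lookup f m * (\<Prod>i\<in>UNIV. (v $ i) ^ Poly_Mapping.lookup m i))"

text \<open>The substitution \<open>x\<^sub>i \<mapsto> \<Sum>\<^sub>j A\<^sub>i\<^sub>j x\<^sub>j\<close>.\<close>

definition linear_change ::
    "'a ^ 'n ^ 'n \<Rightarrow> ('a::field, 'n::finite) polynomial \<Rightarrow> ('a, 'n) polynomial"
  where "linear_change A f =
    (\<Sum>m\<in>Poly_Mapping.keys f. const_poly (Poly_Mapping.lookup f m) *
       (\<Prod>i\<in>UNIV. (\<Sum>j\<in>UNIV. const_poly (A $ i $ j) * indet j) ^ Poly_Mapping.lookup m i))"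

definition indets :: "('a::field, 'n::finite) polynomial \<Rightarrow> 'n set"
  where "indets f = (\<Union>m\<in>Poly_Mapping.keys f. Poly_Mapping.keys m)"

definition form_rank :: "('a::field, 'n::finite) polynomial \<Rightarrow> nat"
  where "form_rank f = (LEAST r. \<exists>A. invertible A \<and> r = card (indets (linear_change A f)))"

subsection \<open>Projective space\<close>

text \<open>A point of projective space is a one-dimensional linear subspace of \<open>'a ^ 'n\<close>.\<close>

type_synonym ('a, 'n) point = "('a ^ 'n) set"

definition points_of :: "('a::field ^ 'n::finite) set \<Rightarrow> ('a, 'n) point set"
  where "points_of W = {P. vec.subspace P \<and> vec.dim P = 1 \<and> P \<subseteq> W}"

definition zero_set :: "('a::field, 'n::finite) polynomial \<Rightarrow> ('a, 'n) point set"
  where "zero_set f = {P \<in> points_of UNIV. \<forall>v\<in>P. v \<noteq> 0 \<longrightarrow> eval_poly f v = 0}"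

text \<open>
  The projective dimension of \<open>points_of W\<close> is \<open>dim W - 1\<close>; the value is \<open>-1\<close> if \<open>S\<close> has no points.
\<close>

definition projective_index :: "('a::{field, finite}, 'n::finite) point set \<Rightarrow> int"
  where "projective_index S = Max {int (vec.dim W) - 1 | W. vec.subspace W \<and> points_of W \<subseteq> S}"

subsection \<open>Codes\<close>

text \<open>
  Words over the finite coordinate set \<open>S\<close> are the vectors with coordinates indexed by all of the
  finite type \<open>'p\<close> that vanish outside \<open>S\<close>; this is a copy of \<open>F_q^|S|\<close>.
\<close>

definition words_on :: "'p::finite set \<Rightarrow> ('a::{field, finite} ^ 'p) set"
  where "words_on S = {w. \<forall>P. P \<notin> S \<longrightarrow> w $ P = 0}"

definition hamming_weight :: "'a::{field, finite} ^ 'p::finite \<Rightarrow> nat"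
  where "hamming_weight w = card {P. w $ P \<noteq> 0}"

definition minimum_distance :: "('a::{field, finite} ^ 'p::finite) set \<Rightarrow> nat"
  where "minimum_distance C = Min (hamming_weight ` (C - {0}))"

definition is_linear_code ::
    "'p::finite set \<Rightarrow> ('a::{field, finite} ^ 'p) set \<Rightarrow> nat \<Rightarrow> nat \<Rightarrow> nat \<Rightarrow> bool"
  where "is_linear_code S C n k d \<longleftrightarrow>
    C \<subseteq> words_on S \<and> vec.subspace C \<and> C \<noteq> {0} \<and>
    card S = n \<and> vec.dim C = k \<and> minimum_distance C = d"

text \<open>
  The value \<open>c\<^sub>x(f) = f(x\<^sub>0, \<dots>) / x\<^sub>i\<^sup>2\<close> with \<open>i\<close> the smallest index such that \<open>x\<^sub>i \<noteq> 0\<close>; for a form of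
  degree 2 it does not depend on the chosen representative \<open>v\<close> of the point.
\<close>

definition point_value ::
    "('a::field, 'n::{finite, linorder}) polynomial \<Rightarrow> ('a, 'n) point \<Rightarrow> 'a"
  where "point_value f P =
    (let v = (SOME v. v \<in> P \<and> v \<noteq> 0); i = (LEAST i. v $ i \<noteq> 0)
     in eval_poly f v / (v $ i)\<^sup>2)"

definition codeword ::
    "('a::{field, finite}, 'n::{finite, linorder}) point set \<Rightarrow> ('a, 'n) polynomial
      \<Rightarrow> 'a ^ ('a, 'n) point"
  where "codeword S f = (\<chi> P. if P \<in> S then point_value f P else 0)"

definition functional_code ::
    "('a::{field, finite}, 'n::{finite, linorder}) point set \<Rightarrow> ('a ^ ('a, 'n) point) set"
  where "functional_code S = codeword S ` quadratic_forms"

end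

theory Submission
  imports Defs "HOL-Computational_Algebra.Polynomial"
begin

text \<open>
  Over every field a quadratic form is determined by its values, so one can work with quadratic maps
  instead of formal polynomials. The rank and index hypotheses make the radical of the form a line
  \<open>\<langle>p\<rangle>\<close>, and every singular vector \<open>u\<close> off that line is part of a basis \<open>p, s, u, x, y\<close> in which the
  form is \<open>\<alpha> \<beta> + N(\<xi>, \<eta>)\<close> with \<open>N\<close> anisotropic; the vertex is \<open>p\<close>, and off the ruling through \<open>u\<close>
  the cone consists of the points \<open>(t, 1, -N(\<xi>, \<eta>), \<xi>, \<eta>)\<close>. If a second quadric meets the cone
  outside the vertex, let \<open>u\<close> be such a point: then the coefficient of \<open>\<beta>\<^sup>2\<close> vanishes, so the second
  form restricts to a polynomial of degree at most 3 in \<open>t, \<xi>, \<eta>\<close>, which has at most \<open>3 q\<^sup>2\<close> zeros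
  unless it is zero, that is, unless the forms are proportional. Together with the at most \<open>q + 1\<close>
  points on the ruling this is the bound. For \<open>q \<ge> 4\<close> the bound shows that only multiples of the form
  vanish on the cone; for \<open>q = 3\<close> this follows by reducing the cubic modulo \<open>\<xi>\<^sup>3 - \<xi>\<close> and \<open>\<eta>\<^sup>3 - \<eta>\<close>.
\<close>

abbreviation lookup where "lookup \<equiv> Poly_Mapping.lookup"
abbreviation keys where "keys \<equiv> Poly_Mapping.keys"

section \<open>Evaluation of formal polynomials\<close>

lemma poly_mapping_eq_sum_single:
  fixes f :: "'b \<Rightarrow>\<^sub>0 'a::comm_monoid_add"
  shows "f = (\<Sum>m\<in>keys f. Poly_Mapping.single m (lookup f m))"
  by (rule poly_mapping_eqI) (simp add: lookup_sum lookup_single when_def in_keys_iff)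

text \<open>Addition may cancel coefficients, so \<open>keys (f + g)\<close> can be smaller than the
  union; over a common finite superset coefficients add termwise.\<close>

lemma eval_poly_superset:
  assumes "finite K" "keys f \<subseteq> K"
  shows "eval_poly f v = (\<Sum>m\<in>K. lookup f m * (\<Prod>i\<in>UNIV. (v $ i) ^ lookup m i))"
  unfolding eval_poly_def using assms by (intro sum.mono_neutral_left) (auto simp: in_keys_iff)

lemma eval_poly_zero [simp]: "eval_poly 0 v = 0"
  by (simp add: eval_poly_def)

lemma eval_poly_add: "eval_poly (f + g) v = eval_poly f v + eval_poly g v"
  by (subst (1 2 3) eval_poly_superset[of "keys f \<union> keys g"])
     (simp_all add: keys_add lookup_add distrib_right sum.distrib)

lemma eval_poly_sum: "eval_poly (sum F I) v = (\<Sum>i\<in>I. eval_poly (F i) v)"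
  by (induction I rule: infinite_finite_induct) (simp_all add: eval_poly_add)

lemma eval_poly_single:
  "eval_poly (Poly_Mapping.single m c) v = c * (\<Prod>i\<in>UNIV. (v $ i) ^ lookup m i)"
  by (subst eval_poly_superset[of "{m}"]) auto

lemma eval_poly_mult: "eval_poly (f * g) v = eval_poly f v * eval_poly g v"
proof -
  have "f * g = (\<Sum>m\<in>keys f. \<Sum>n\<in>keys g. Poly_Mapping.single (m + n) (lookup f m * lookup g n))"
    by (subst (1) poly_mapping_eq_sum_single[of f], subst (1) poly_mapping_eq_sum_single[of g])
       (simp only: sum_product mult_single)
  then show ?thesis
    by (simp add: eval_poly_sum eval_poly_single lookup_add power_add prod.distrib)
       (simp add: eval_poly_def sum_product mult_ac)
qed

lemma eval_poly_const [simp]: "eval_poly (const_poly c) v = c"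
  by (simp add: const_poly_def eval_poly_single)

lemma eval_poly_one [simp]: "eval_poly 1 v = 1"
  by (metis eval_poly_const const_poly_def single_one)

lemma eval_poly_indet [simp]: "eval_poly (indet j) v = v $ j"
proof -
  have "(\<Prod>i\<in>UNIV. (v $ i) ^ (1 when j = i)) = (\<Prod>i\<in>UNIV. if j = i then v $ i else 1)"
    by (rule prod.cong) (auto simp: when_def)
  then show ?thesis
    by (simp add: indet_def eval_poly_single lookup_single)
qed

lemma eval_poly_power: "eval_poly (f ^ k) v = eval_poly f v ^ k"
  by (induction k) (simp_all add: eval_poly_mult)

lemma eval_poly_prod: "eval_poly (prod F I) v = (\<Prod>i\<in>I. eval_poly (F i) v)"
  by (induction I rule: infinite_finite_induct) (simp_all add: eval_poly_mult)

lemma eval_poly_linear_change: "eval_poly (linear_change A f) v = eval_poly f (A *v v)"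
  unfolding linear_change_def
  by (simp add: eval_poly_sum eval_poly_mult eval_poly_prod eval_poly_power)
     (simp add: eval_poly_def matrix_vector_mult_def)

section \<open>Homogeneous polynomials and linear substitution\<close>

definition homogeneous :: "nat \<Rightarrow> ('a::field, 'n::finite) polynomial set"
  where "homogeneous d = {f. \<forall>m\<in>keys f. monom_degree m = d}"

lemma quadratic_forms_eq_homogeneous: "quadratic_forms = homogeneous 2"
  by (simp add: quadratic_forms_def homogeneous_def)

lemma homogeneous_zero [simp]: "0 \<in> homogeneous d"
  by (simp add: homogeneous_def)

lemma homogeneous_add: "f \<in> homogeneous d \<Longrightarrow> g \<in> homogeneous d \<Longrightarrow> f + g \<in> homogeneous d"
  using keys_add[of f g] by (auto simp: homogeneous_def)

lemma homogeneous_sum: "(\<And>i. i \<in> I \<Longrightarrow> F i \<in> homogeneous d) \<Longrightarrow> sum F I \<in> homogeneous d"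
  by (induction I rule: infinite_finite_induct) (auto intro: homogeneous_add)

lemma homogeneous_mult:
  assumes "f \<in> homogeneous d" "g \<in> homogeneous e"
  shows "f * g \<in> homogeneous (d + e)"
  using assms keys_mult[of f g]
  by (fastforce simp: homogeneous_def monom_degree_def lookup_add sum.distrib)

lemma homogeneous_const: "const_poly c \<in> homogeneous 0"
  by (auto simp: homogeneous_def const_poly_def monom_degree_def split: if_splits)

lemma homogeneous_power: "f \<in> homogeneous d \<Longrightarrow> f ^ k \<in> homogeneous (d * k)"
proof (induction k)
  case 0
  then show ?case using homogeneous_const[of 1] by (simp add: const_poly_def)
next
  case (Suc k)
  then show ?case using homogeneous_mult[of f d "f ^ k" "d * k"] by simp
qed

lemma homogeneous_prod:
  "(\<And>i. i \<in> I \<Longrightarrow> F i \<in> homogeneous (D i)) \<Longrightarrow> prod F I \<in> homogeneous (sum D I)"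
proof (induction I rule: infinite_finite_induct)
  case (insert i I)
  then show ?case using homogeneous_mult[of "F i" "D i"] by simp
qed (use homogeneous_const[of 1] in \<open>simp_all add: const_poly_def\<close>)

lemma homogeneous_indet: "indet j \<in> homogeneous 1"
  by (auto simp: homogeneous_def indet_def monom_degree_def lookup_single when_def)

text \<open>A substitution builds powers and products of linear forms step by step, so intermediate
  factors have degrees other than 2; hence the general \<open>d\<close>.\<close>

lemma homogeneous_linear_change:
  assumes "f \<in> homogeneous d"
  shows "linear_change A f \<in> homogeneous d"
  unfolding linear_change_def
proof (rule homogeneous_sum)
  fix m assume m: "m \<in> keys f"
  have lin: "(\<Sum>j\<in>UNIV. const_poly (A $ i $ j) * indet j) \<in> homogeneous 1" for i
    using homogeneous_mult[OF homogeneous_const homogeneous_indet] by (intro homogeneous_sum) simp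
  have "(\<Prod>i\<in>UNIV. (\<Sum>j\<in>UNIV. const_poly (A $ i $ j) * indet j) ^ lookup m i)
      \<in> homogeneous (\<Sum>i\<in>UNIV. 1 * lookup m i)"
    by (intro homogeneous_prod homogeneous_power lin)
  moreover have "(\<Sum>i\<in>UNIV. 1 * lookup m i) = d"
    using assms m by (simp add: homogeneous_def monom_degree_def)
  ultimately show "const_poly (lookup f m) *
      (\<Prod>i\<in>UNIV. (\<Sum>j\<in>UNIV. const_poly (A $ i $ j) * indet j) ^ lookup m i) \<in> homogeneous d"
    using homogeneous_mult[OF homogeneous_const] by force
qed

lemma quadratic_forms_linear_change:
  "f \<in> quadratic_forms \<Longrightarrow> linear_change A f \<in> quadratic_forms"
  by (simp add: quadratic_forms_eq_homogeneous homogeneous_linear_change)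

lemma quadratic_forms_add: "f \<in> quadratic_forms \<Longrightarrow> g \<in> quadratic_forms \<Longrightarrow> f + g \<in> quadratic_forms"
  by (simp add: quadratic_forms_eq_homogeneous homogeneous_add)

lemma quadratic_forms_smult: "f \<in> quadratic_forms \<Longrightarrow> const_poly c * f \<in> quadratic_forms"
  unfolding quadratic_forms_eq_homogeneous using homogeneous_mult[OF homogeneous_const] by force

lemma const_poly_uminus_one_mult: "const_poly (- 1) * f = - f"
  by (simp add: const_poly_def single_uminus)

lemma quadratic_forms_diff:
  "f \<in> quadratic_forms \<Longrightarrow> g \<in> quadratic_forms \<Longrightarrow> f - g \<in> quadratic_forms"
  using quadratic_forms_add[of f "- g"] quadratic_forms_smult[of g "- 1"]
  by (simp add: const_poly_uminus_one_mult)

lemma eval_poly_diff: "eval_poly (f - g) v = eval_poly f v - eval_poly g v"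
  by (metis add_diff_cancel diff_add_cancel eval_poly_add)

text \<open>Peel off a variable of positive exponent twice; \<open>i = j\<close> is allowed and
  gives the squares.\<close>

lemma quadratic_monom_cases:
  assumes "monom_degree (m :: 'n::finite \<Rightarrow>\<^sub>0 nat) = 2"
  obtains i j where "m = Poly_Mapping.single i 1 + Poly_Mapping.single j 1"
proof -
  have split: "\<exists>i m'. m = Poly_Mapping.single i 1 + m' \<and> monom_degree m' = d"
    if d: "monom_degree m = Suc d" for m :: "'n \<Rightarrow>\<^sub>0 nat" and d
  proof -
    obtain i where i: "lookup m i \<noteq> 0"
      using d unfolding monom_degree_def by (metis Zero_not_Suc sum.neutral)
    define m' where "m' = m - Poly_Mapping.single i 1"
    have "m = Poly_Mapping.single i 1 + m'"
      unfolding m'_def using i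
      by (intro poly_mapping_eqI) (auto simp: lookup_add lookup_minus lookup_single when_def)
    moreover from this have "monom_degree m' = d"
      using d by (simp add: monom_degree_def lookup_add lookup_single when_def sum.distrib)
    ultimately show ?thesis by blast
  qed
  obtain i m' where 1: "m = Poly_Mapping.single i 1 + m'" "monom_degree m' = Suc 0"
    using split[of m "Suc 0"] assms by (auto simp: numeral_2_eq_2)
  obtain j m'' where 2: "m' = Poly_Mapping.single j 1 + m''" "monom_degree m'' = 0"
    using split[of m' 0] 1 by auto
  have "m'' = 0"
    using 2(2) by (intro poly_mapping_eqI) (simp add: monom_degree_def)
  with 1 2 that show ?thesis by simp
qed

lemma eval_quadratic_monom:
  fixes v :: "'a::field ^ 'n::finite"
  shows "(\<Prod>k\<in>UNIV. (v $ k) ^ lookup (Poly_Mapping.single i 1 + Poly_Mapping.single j 1) k) = v $ i * v $ j"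
proof -
  have "(\<Prod>k\<in>UNIV. (v $ k) ^ (1 when i = k)) = v $ i" for i :: 'n
    using eval_poly_indet[of i v] by (simp add: indet_def eval_poly_single lookup_single)
  then show ?thesis
    by (simp add: lookup_add lookup_single power_add prod.distrib)
qed

text \<open>Over every field, also over the field with two elements, a quadratic form is determined by
  its values; this is the coordinatewise version of that fact.\<close>

lemma not_in_indets_if_independent:
  fixes f :: "('a::field, 'n::finite) polynomial"
  assumes f: "f \<in> quadratic_forms"
    and indep: "\<And>v t. eval_poly f (v + t *s axis k 1) = eval_poly f v"
  shows "k \<notin> indets f"
proof
  assume "k \<in> indets f"
  then obtain m0 where m0: "m0 \<in> keys f \<and> k \<in> keys m0"
    by (auto simp: indets_def)
  \<comment> \<open>Among the monomials containing \<open>k\<close> take one with smallest support: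
    no other monomial of \<open>f\<close> containing \<open>k\<close> can then live on that
    support.\<close>
  define m where "m = arg_min (\<lambda>m. card (keys m)) (\<lambda>m. m \<in> keys f \<and> k \<in> keys m)"
  have m: "m \<in> keys f" "k \<in> keys m"
    and minimal: "\<And>m'. m' \<in> keys f \<Longrightarrow> k \<in> keys m' \<Longrightarrow> card (keys m) \<le> card (keys m')"
    using arg_min_nat_lemma[of "\<lambda>m. m \<in> keys f \<and> k \<in> keys m" m0 "\<lambda>m. card (keys m)"] m0
    unfolding m_def by auto
  \<comment> \<open>At a 0-1 vector a monomial takes the value 1 or 0 according to whether its
    support lies in \<open>S\<close>; such vectors exist over every field, also with two
    elements.\<close>
  define ind :: "'n set \<Rightarrow> 'a ^ 'n" where "ind S = (\<chi> i. if i \<in> S then 1 else 0)" for S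
  have mon: "(\<Prod>i\<in>UNIV. (ind S $ i) ^ lookup m' i) = (if keys m' \<subseteq> S then 1 else 0)" for S m'
  proof (cases "keys m' \<subseteq> S")
    case True
    then have "(ind S $ i) ^ lookup m' i = 1" for i
      by (cases "lookup m' i = 0") (auto simp: ind_def in_keys_iff subset_iff)
    with True show ?thesis by simp
  next
    case False
    then show ?thesis
      by (auto simp: ind_def in_keys_iff subset_iff)
  qed
  \<comment> \<open>This uses degree 2: the support then determines the monomial, one variable
    meaning a square and two meaning their product.\<close>
  have same: "m' = m" if "m' \<in> keys f" "k \<in> keys m'" "keys m' \<subseteq> keys m" for m'
  proof -
    have keq: "keys m' = keys m"
      using minimal[OF that(1,2)] that(3) by (simp add: card_seteq)
    have "monom_degree m = 2" "monom_degree m' = 2"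
      using f m(1) that(1) by (simp_all add: quadratic_forms_def)
    then obtain i j i' j' where ij: "m = Poly_Mapping.single i 1 + Poly_Mapping.single j 1"
        "m' = Poly_Mapping.single i' 1 + Poly_Mapping.single j' 1"
      by (elim quadratic_monom_cases)
    have "keys (Poly_Mapping.single i (1::nat) + Poly_Mapping.single j 1) = {i, j}" for i j :: 'n
      by (auto simp: in_keys_iff lookup_add lookup_single when_def split: if_splits)
    with keq ij have "{i, j} = {i', j'}" by metis
    then show ?thesis
      unfolding ij doubleton_eq_iff by (auto simp: add.commute)
  qed
  \<comment> \<open>Dropping \<open>k\<close> from the support subtracts exactly the monomials that
    contain \<open>k\<close> and live on \<open>keys m\<close>, so the difference is the coefficient
    of \<open>m\<close>.\<close>
  have "ind (keys m) = ind (keys m - {k}) + 1 *s axis k 1"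
    using m(2) by (auto simp: vec_eq_iff ind_def axis_def)
  then have "0 = eval_poly f (ind (keys m)) - eval_poly f (ind (keys m - {k}))"
    using indep[of "ind (keys m - {k})" 1] by simp
  also have "\<dots> = (\<Sum>m'\<in>keys f. if m' = m then lookup f m' else 0)"
    unfolding eval_poly_def mon sum_subtractf[symmetric]
    using same m by (intro sum.cong) auto
  also have "\<dots> = lookup f m"
    using m(1) by simp
  finally show False
    using m(1) by (simp add: in_keys_iff)
qed

lemma quadratic_form_eqI:
  assumes "f \<in> quadratic_forms" "g \<in> quadratic_forms" "\<And>v. eval_poly f v = eval_poly g v"
  shows "f = g"
proof -
  let ?h = "f - g"
  have h: "?h \<in> quadratic_forms"
    by (rule quadratic_forms_diff) fact+
  have "k \<notin> indets ?h" for k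
    by (rule not_in_indets_if_independent[OF h]) (simp add: eval_poly_diff assms(3))
  then have "m = 0" if "m \<in> keys ?h" for m
    using that unfolding indets_def by (metis UN_I equals0I keys_eq_empty)
  then have "keys ?h = {}"
    using h by (fastforce simp: quadratic_forms_def monom_degree_def)
  then show ?thesis by simp
qed

text \<open>The converse of \<open>not_in_indets_if_independent\<close>, for polynomials of any
  degree.\<close>

lemma eval_poly_independent:
  assumes "k \<notin> indets f"
  shows "eval_poly f (v + t *s axis k 1) = eval_poly f v"
  unfolding eval_poly_def
proof (intro sum.cong refl arg_cong2[where f = "(*)"] prod.cong)
  fix m i assume "m \<in> keys f"
  with assms have "lookup m k = 0"
    by (auto simp: indets_def in_keys_iff)
  then show "((v + t *s axis k 1) $ i) ^ lookup m i = (v $ i) ^ lookup m i"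
    by (cases "i = k") (auto simp: axis_def)
qed

section \<open>Quadratic maps\<close>

definition polar :: "('b::ab_group_add \<Rightarrow> 'a::ab_group_add) \<Rightarrow> 'b \<Rightarrow> 'b \<Rightarrow> 'a"
  where "polar Q v w = Q (v + w) - Q v - Q w"

text \<open>Homogeneity together with a bilinear polar form is the notion that also works in
  characteristic 2. Linearity in the first argument suffices, as \<open>polar\<close> is
  symmetric.\<close>

definition quadratic_map :: "('a::field ^ 'n \<Rightarrow> 'a) \<Rightarrow> bool"
  where "quadratic_map Q \<longleftrightarrow> (\<forall>c v. Q (c *s v) = c\<^sup>2 * Q v) \<and>
    (\<forall>u v w. polar Q (u + v) w = polar Q u w + polar Q v w) \<and>
    (\<forall>c v w. polar Q (c *s v) w = c * polar Q v w)"

text \<open>The property is stable under sums and scalar multiples, so only the products of two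
  coordinates have to be checked.\<close>

lemma quadratic_map_eval_poly:
  fixes f :: "('a::field, 'b::finite) polynomial"
  assumes "f \<in> quadratic_forms"
  shows "quadratic_map (eval_poly f)"
proof -
  have mon: "quadratic_map (\<lambda>v. \<Prod>i\<in>UNIV. (v $ i) ^ lookup m i :: 'a)" if "m \<in> keys f" for m
  proof -
    have "monom_degree m = 2"
      using assms that by (simp add: quadratic_forms_def)
    then obtain i j where m: "m = Poly_Mapping.single i 1 + Poly_Mapping.single j 1"
      by (rule quadratic_monom_cases)
    have "polar (\<lambda>v. v $ i * v $ j) v w = v $ i * w $ j + w $ i * v $ j" for v w :: "'a ^ 'b"
      by (simp add: polar_def distrib_left distrib_right)
    then show ?thesis
      unfolding m eval_quadratic_monom quadratic_map_def
      by (simp add: distrib_left distrib_right power2_eq_square mult_ac add_ac)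
  qed
  have smult: "quadratic_map (\<lambda>v. c * Q v)" if "quadratic_map Q" for c and Q :: "'a ^ 'b \<Rightarrow> 'a"
  proof -
    have "polar (\<lambda>v. c * Q v) v w = c * polar Q v w" for v w
      by (simp add: polar_def right_diff_distrib)
    with that show ?thesis unfolding quadratic_map_def by (simp add: algebra_simps)
  qed
  have add: "quadratic_map (\<lambda>v. Q v + R v)" if "quadratic_map Q" "quadratic_map R"
    for Q R :: "'a ^ 'b \<Rightarrow> 'a"
  proof -
    have "polar (\<lambda>v. Q v + R v) v w = polar Q v w + polar R v w" for v w
      by (simp add: polar_def)
    with that show ?thesis unfolding quadratic_map_def by (simp add: algebra_simps)
  qed
  have sum: "quadratic_map (\<lambda>v. \<Sum>m\<in>K. Q m v)"
    if "finite K" "\<And>m. m \<in> K \<Longrightarrow> quadratic_map (Q m)"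
    for K :: "('b \<Rightarrow>\<^sub>0 nat) set" and Q :: "_ \<Rightarrow> 'a ^ 'b \<Rightarrow> 'a"
    using that
  proof (induction K)
    case empty
    show ?case by (simp add: quadratic_map_def polar_def)
  qed (simp add: add)
  show ?thesis
    unfolding eval_poly_def by (intro sum smult mon) auto
qed

section \<open>Zeros of polynomials of low degree\<close>

text \<open>A fibre has at most \<open>k\<close> zeros if its coefficient at \<open>k\<close> is
  nonzero; otherwise it is charged with the whole field.\<close>

lemma card_zeros_family_le:
  fixes p :: "'b::finite \<Rightarrow> 'a::{field, finite} poly"
  assumes "\<And>b. degree (p b) \<le> k"
  shows "card {(b, t). poly (p b) t = 0} \<le> k * CARD('b) + CARD('a) * card {b. coeff (p b) k = 0}"
proof -
  have fibre: "card {t. poly (p b) t = 0} \<le> k + (if coeff (p b) k = 0 then CARD('a) else 0)" for b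
  proof (cases "coeff (p b) k = 0")
    case True
    have "card {t. poly (p b) t = 0} \<le> CARD('a)"
      by (rule card_mono) auto
    with True show ?thesis by simp
  next
    case False
    then have "p b \<noteq> 0" by auto
    then have "card {t. poly (p b) t = 0} \<le> degree (p b)"
      by (rule card_poly_roots_bound)
    with False assms[of b] show ?thesis by simp
  qed
  have "card {(b, t). poly (p b) t = 0} = card (SIGMA b:UNIV. {t. poly (p b) t = 0})"
    by (rule arg_cong[where f = card]) auto
  also have "\<dots> = (\<Sum>b\<in>UNIV. card {t. poly (p b) t = 0})"
    by (rule card_SigmaI) auto
  also have "\<dots> \<le> (\<Sum>b\<in>UNIV. k + (if coeff (p b) k = 0 then CARD('a) else 0))"
    by (intro sum_mono fibre)
  also have "\<dots> = k * CARD('b) + CARD('a) * card {b. coeff (p b) k = 0}"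
    by (simp add: sum.distrib sum.If_cases)
  finally show ?thesis .
qed

text \<open>Bounds the total degree of a polynomial in two variables: the outer exponent counts the
  first variable, the coefficients are polynomials in the second.\<close>

definition total_degree_le :: "'a::zero poly poly \<Rightarrow> nat \<Rightarrow> bool"
  where "total_degree_le r d \<longleftrightarrow> (\<forall>i. coeff r i \<noteq> 0 \<longrightarrow> i + degree (coeff r i) \<le> d)"

lemma total_degree_le_singleton: "degree c = 0 \<Longrightarrow> total_degree_le [:c:] 0"
  by (simp add: total_degree_le_def coeff_pCons split: nat.split)

lemma total_degree_le_pCons:
  "degree c \<le> Suc d \<Longrightarrow> total_degree_le r d \<Longrightarrow> total_degree_le (pCons c r) (Suc d)"
  by (auto simp: total_degree_le_def coeff_pCons split: nat.split)

text \<open>The Schwartz-Zippel bound in two variables. With \<open>k\<close> the degree in the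
  first variable, the leading coefficient vanishes for at most \<open>d - k\<close> values of the
  second; these cost \<open>q\<close> zeros each, all others at most \<open>k\<close>.\<close>

lemma card_zeros_bivariate_le:
  fixes r :: "'a::{field, finite} poly poly"
  assumes "r \<noteq> 0" and deg: "total_degree_le r d"
  shows "card {(x, y). poly (poly r [:x:]) y = 0} \<le> d * CARD('a)"
proof -
  let ?k = "degree r"
  \<comment> \<open>The inner variable is specialised first, which gives a family of polynomials in
    the outer one.\<close>
  define p where "p y = map_poly (\<lambda>c. poly c y) r" for y
  have coeff_p: "coeff (p y) i = poly (coeff r i) y" for y i
    by (simp add: p_def coeff_map_poly)
  have deg_p: "degree (p y) \<le> ?k" for y
    by (rule degree_le) (simp add: coeff_p coeff_eq_0)
  have poly_p: "poly (p y) x = poly (poly r [:x:]) y" for x y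
  proof -
    have "poly (poly r [:x:]) y = (\<Sum>i\<le>degree r. poly (coeff r i) y * x ^ i)"
      by (simp add: poly_altdef[of r "[:x:]"] poly_sum)
    also have "\<dots> = poly (p y) x"
      unfolding poly_altdef[of "p y"] coeff_p[symmetric]
      using deg_p[of y] by (intro sum.mono_neutral_right) (auto simp: not_le coeff_eq_0)
    finally show ?thesis by simp
  qed
  note le = card_zeros_family_le[of p, OF deg_p]
  have lead: "coeff r ?k \<noteq> 0"
    using \<open>r \<noteq> 0\<close> by simp
  have k: "?k + degree (coeff r ?k) \<le> d"
    using deg lead by (simp add: total_degree_le_def)
  have "card {y. coeff (p y) ?k = 0} \<le> degree (coeff r ?k)"
    unfolding coeff_p using lead by (rule card_poly_roots_bound)
  then have "card {y. coeff (p y) ?k = 0} \<le> d - ?k"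
    using k by simp
  then have "CARD('a) * card {y. coeff (p y) ?k = 0} \<le> CARD('a) * (d - ?k)"
    by simp
  with le have "card {(y, x). poly (p y) x = 0} \<le> ?k * CARD('a) + CARD('a) * (d - ?k)"
    by linarith
  also have "\<dots> = d * CARD('a)"
    using k by (simp add: algebra_simps flip: distrib_left)
  also have "{(y, x). poly (p y) x = 0} = prod.swap ` {(x, y). poly (poly r [:x:]) y = 0}"
    by (auto simp: poly_p)
  finally show ?thesis
    by (simp add: card_image)
qed

text \<open>Split by the highest power of \<open>t\<close> that survives. The counts are at most
  2q^2, then q^2 + q * 2q, then q * 3q; the degree bounds 2 and 3 make each of them at most
  3q^2.\<close>

lemma card_zeros_quadratic_family_le:
  fixes l r :: "'a::{field, finite} poly poly" and a :: 'a
  assumes nonzero: "a \<noteq> 0 \<or> l \<noteq> 0 \<or> r \<noteq> 0"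
    and degl: "total_degree_le l 2" and degr: "total_degree_le r 3"
  shows "card {((x, y), t). a * t\<^sup>2 + t * poly (poly l [:x:]) y + poly (poly r [:x:]) y = 0}
    \<le> 3 * CARD('a)\<^sup>2"
proof -
  let ?l = "\<lambda>(x, y). poly (poly l [:x:]) y" and ?r = "\<lambda>(x, y). poly (poly r [:x:]) y"
  define p where "p b = [:?r b, ?l b, a:]" for b
  have eq: "{((x, y), t). a * t\<^sup>2 + t * poly (poly l [:x:]) y + poly (poly r [:x:]) y = 0}
      = {(b, t). poly (p b) t = 0}"
    by (auto simp: p_def algebra_simps power2_eq_square)
  have q: "CARD('a \<times> 'a) = CARD('a)\<^sup>2"
    by (simp add: power2_eq_square)
  consider "a \<noteq> 0" | "a = 0" "l \<noteq> 0" | "a = 0" "l = 0" "r \<noteq> 0"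
    using nonzero by blast
  then have "card {(b, t). poly (p b) t = 0} \<le> 3 * CARD('a)\<^sup>2"
  proof cases
    case 1
    then have "card {(b, t). poly (p b) t = 0} \<le> 2 * CARD('a \<times> 'a) + CARD('a) * card {b. coeff (p b) 2 = 0}"
      by (intro card_zeros_family_le) (simp add: p_def)
    with 1 show ?thesis
      unfolding q by (simp add: p_def numeral_2_eq_2)
  next
    case 2
    then have "card {(b, t). poly (p b) t = 0} \<le> 1 * CARD('a \<times> 'a) + CARD('a) * card {b. coeff (p b) 1 = 0}"
      by (intro card_zeros_family_le) (simp add: p_def)
    moreover have "{b. coeff (p b) 1 = 0} = {(x, y). poly (poly l [:x:]) y = 0}"
      by (auto simp: p_def)
    moreover have "CARD('a) * card {(x, y). poly (poly l [:x:]) y = 0} \<le> 2 * CARD('a)\<^sup>2"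
      using mult_le_mono2[OF card_zeros_bivariate_le[OF 2(2) degl], of "CARD('a)"]
      by (simp add: power2_eq_square mult_ac)
    ultimately show ?thesis
      unfolding q by simp
  next
    case 3
    then have "card {(b, t). poly (p b) t = 0} \<le> 0 * CARD('a \<times> 'a) + CARD('a) * card {b. coeff (p b) 0 = 0}"
      by (intro card_zeros_family_le) (simp add: p_def split_beta)
    moreover have "{b. coeff (p b) 0 = 0} = {(x, y). poly (poly r [:x:]) y = 0}"
      by (auto simp: p_def)
    moreover have "CARD('a) * card {(x, y). poly (poly r [:x:]) y = 0} \<le> 3 * CARD('a)\<^sup>2"
      using mult_le_mono2[OF card_zeros_bivariate_le[OF 3(3) degr], of "CARD('a)"]
      by (simp add: power2_eq_square mult_ac)
    ultimately show ?thesis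
      unfolding q by simp
  qed
  then show ?thesis by (simp only: eq)
qed

section \<open>Coordinates on the cone\<close>

lemma polar_commute: "polar Q v w = polar Q w v"
  by (simp add: polar_def add.commute)

lemma polar_add_expand: "Q (v + w) = Q v + Q w + polar Q v w"
  by (simp add: polar_def)

lemma
  assumes "quadratic_map Q"
  shows quadratic_map_scale: "Q (c *s v) = c\<^sup>2 * Q v"
    and polar_add_left: "polar Q (u + v) w = polar Q u w + polar Q v w"
    and polar_scale_left: "polar Q (c *s v) w = c * polar Q v w"
    and polar_add_right: "polar Q w (u + v) = polar Q w u + polar Q w v"
    and polar_scale_right: "polar Q w (c *s v) = c * polar Q w v"
  using assms unfolding quadratic_map_def polar_commute[of Q w] by blast+

lemma polar_diff_right: "quadratic_map Q \<Longrightarrow> polar Q w (u - v) = polar Q w u - polar Q w v"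
  by (metis add_diff_cancel diff_add_cancel polar_add_right)

lemmas quadratic_map_simps =
  quadratic_map_scale polar_add_left polar_scale_left polar_add_right polar_scale_right
  polar_diff_right

lemma quadratic_map_zero: "quadratic_map Q \<Longrightarrow> Q 0 = 0"
  using quadratic_map_scale[of Q 0 0] by simp

lemma polar_self: "quadratic_map Q \<Longrightarrow> polar Q v v = 2 * Q v"
  using quadratic_map_scale[of Q 2 v] polar_add_expand[of Q v v] vec.scale_left_distrib[of 1 1 v]
  by simp

text \<open>A Witt decomposition: the radical vector \<open>p\<close>, the hyperbolic pair
  \<open>s\<close>, \<open>u\<close>, and the anisotropic plane of \<open>x\<close>,
  \<open>y\<close> orthogonal to that pair. The basis property is stated as a bijection with
  coordinates, ready for counting.\<close>

locale cone_frame =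
  fixes Q :: "'a::{field, finite} ^ 5 \<Rightarrow> 'a" and p s u x y :: "'a ^ 5"
  assumes quadratic: "quadratic_map Q"
    and Q_p: "Q p = 0" and Q_s: "Q s = 0" and Q_u: "Q u = 0"
    and polar_p: "polar Q p v = 0"
    and polar_s_u: "polar Q s u = 1"
    and polar_s_x: "polar Q s x = 0" and polar_s_y: "polar Q s y = 0"
    and polar_u_x: "polar Q u x = 0" and polar_u_y: "polar Q u y = 0"
    and anisotropic: "Q (\<xi> *s x + \<eta> *s y) = 0 \<Longrightarrow> \<xi> = 0 \<and> \<eta> = 0"
    and frame_bij: "bij (\<lambda>(t, \<alpha>, \<beta>, \<xi>, \<eta>). t *s p + \<alpha> *s s + \<beta> *s u + \<xi> *s x + \<eta> *s y)"

lemma span_singleton_iff: "w \<in> vec.span {v :: 'a::field ^ 'n} \<longleftrightarrow> (\<exists>c. w = c *s v)"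
  by (auto simp: vec.span_singleton)

text \<open>A singular \<open>u\<close> off the radical has a hyperbolic partner \<open>s\<close>,
  and the orthogonal complement of the pair is large enough to contain \<open>x\<close> and
  \<open>y\<close> independent of \<open>p\<close>. A singular vector in their plane would span with
  \<open>u\<close> and \<open>p\<close> a totally singular 3-space, against
  \<open>index\<close>.\<close>

lemma cone_frame_exists:
  fixes Q :: "'a::{field, finite} ^ 5 \<Rightarrow> 'a"
  assumes quadratic: "quadratic_map Q"
    and p: "p \<noteq> 0" "Q p = 0" "\<And>v. polar Q p v = 0"
    and radical: "\<And>r. Q r = 0 \<Longrightarrow> (\<And>v. polar Q r v = 0) \<Longrightarrow> r \<in> vec.span {p}"
    and index: "\<And>W. vec.subspace W \<Longrightarrow> (\<And>w. w \<in> W \<Longrightarrow> Q w = 0) \<Longrightarrow> vec.dim W \<le> 2"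
    and u: "u \<notin> vec.span {p}" "Q u = 0"
  shows "\<exists>s x y. cone_frame Q p s u x y"
proof -
  note [simp] = quadratic_map_simps[OF quadratic]
  have p_right [simp]: "polar Q v p = 0" for v
    using p(3)[of v] polar_commute[of Q v p] by simp
  have uu [simp]: "polar Q u u = 0"
    using u(2) by (simp add: polar_self[OF quadratic])
  obtain s' where s': "polar Q u s' \<noteq> 0"
    using radical[of u] u by blast
  \<comment> \<open>First scale to pairing 1 with \<open>u\<close>; then subtracting
    \<open>Q s''\<close> times \<open>u\<close> makes the vector singular without changing the
    pairing.\<close>
  define s'' where "s'' = (1 / polar Q u s') *s s'"
  have s''[simp]: "polar Q u s'' = 1"
    using s' by (simp add: s''_def)
  define s where "s = s'' + (- Q s'') *s u"
  have us [simp]: "polar Q u s = 1"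
    unfolding s_def by (simp only: quadratic_map_simps[OF quadratic] s'' uu) simp
  then have su [simp]: "polar Q s u = 1"
    by (simp only: polar_commute[of Q s u])
  have Q_s: "Q s = 0"
    unfolding s_def polar_add_expand[of Q] using u(2) polar_commute[of Q s'' u]
    by (simp only: quadratic_map_simps[OF quadratic] s'') simp
  have ss [simp]: "polar Q s s = 0"
    using Q_s by (simp add: polar_self[OF quadratic])
  define W where "W = {v. polar Q s v = 0 \<and> polar Q u v = 0}"
  define q where "q = CARD('a)"
  have q: "q > 1"
    unfolding q_def using card_mono[of UNIV "{0, 1 :: 'a}"] by simp
  \<comment> \<open>Counting in place of a dimension formula: a vector is recovered from its
    projection to \<open>W\<close> and its two pairings with \<open>s\<close> and
    \<open>u\<close>.\<close>
  have "q ^ 5 \<le> card W * q\<^sup>2"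
  proof -
    define \<phi> where "\<phi> v = (v + (- polar Q u v) *s s + (- polar Q s v) *s u, polar Q s v, polar Q u v)" for v
    have "inj \<phi>"
      by (rule injI) (auto simp: \<phi>_def)
    then have "CARD('a ^ 5) = card (range \<phi>)"
      by (simp add: card_image)
    also have "\<dots> \<le> card (W \<times> (UNIV :: 'a set) \<times> (UNIV :: 'a set))"
      by (rule card_mono) (auto simp: \<phi>_def W_def)
    finally show ?thesis
      by (simp add: card_cartesian_product q_def power2_eq_square)
  qed
  then have "q ^ 3 * q\<^sup>2 \<le> card W * q\<^sup>2"
    by (simp flip: power_add)
  then have W: "q ^ 3 \<le> card W"
    by (rule mult_right_le_imp_le) (use q in simp)
  \<comment> \<open>As q^3 exceeds both q and q^2, \<open>W\<close> is contained neither in the line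
    of \<open>p\<close> nor, below, in the plane of \<open>p\<close> and \<open>x\<close>.\<close>
  have "\<not> W \<subseteq> range (\<lambda>c. c *s p)"
  proof
    assume "W \<subseteq> range (\<lambda>c. c *s p)"
    then have "card W \<le> q"
      unfolding q_def by (meson card_image_le card_mono finite le_trans)
    with W q show False
      using power_strict_increasing[of 1 3 q] by simp
  qed
  then obtain x where x: "x \<in> W" "\<And>c. x \<noteq> c *s p"
    by blast
  have "\<not> W \<subseteq> range (\<lambda>(c, d). c *s p + d *s x)"
  proof
    assume "W \<subseteq> range (\<lambda>(c, d). c *s p + d *s x)"
    then have "card W \<le> card (range (\<lambda>(c, d). c *s p + d *s x))"
      by (simp add: card_mono)
    also have "\<dots> \<le> CARD('a \<times> 'a)"
      by (rule card_image_le) simp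
    also have "\<dots> = q\<^sup>2"
      by (simp add: q_def power2_eq_square)
    also have "q\<^sup>2 < q ^ 3"
      by (rule power_strict_increasing) (use q in simp_all)
    finally show False
      using W by simp
  qed
  then obtain y where y: "y \<in> W" "\<And>c d. y \<noteq> c *s p + d *s x"
    by fast
  have ortho [simp]: "polar Q s x = 0" "polar Q s y = 0" "polar Q u x = 0" "polar Q u y = 0"
    "polar Q x s = 0" "polar Q y s = 0" "polar Q x u = 0" "polar Q y u = 0"
    using x(1) y(1) polar_commute[of Q] by (auto simp: W_def)
  have pxy: "t = 0 \<and> \<xi> = 0 \<and> \<eta> = 0" if "t *s p + \<xi> *s x + \<eta> *s y = 0" for t \<xi> \<eta>
  proof -
    have eq: "t *s p + \<xi> *s x = - (\<eta> *s y)"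
      using that by (simp add: eq_neg_iff_add_eq_0)
    have "\<eta> = 0"
    proof (rule ccontr)
      assume "\<eta> \<noteq> 0"
      then have "y = (- 1 / \<eta>) *s (- (\<eta> *s y))"
        by (simp add: vec_eq_iff)
      also have "\<dots> = (- 1 / \<eta> * t) *s p + (- 1 / \<eta> * \<xi>) *s x"
        unfolding eq[symmetric] by (simp only: vec.scale_right_distrib vec.scale_scale)
      finally show False using y(2) by blast
    qed
    moreover have "\<xi> = 0"
    proof (rule ccontr)
      assume "\<xi> \<noteq> 0"
      have eq': "t *s p = - (\<xi> *s x)"
        using eq \<open>\<eta> = 0\<close> by (simp add: eq_neg_iff_add_eq_0)
      have "x = (- 1 / \<xi>) *s (- (\<xi> *s x))"
        using \<open>\<xi> \<noteq> 0\<close> by (simp add: vec_eq_iff)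
      also have "\<dots> = (- 1 / \<xi> * t) *s p"
        unfolding eq'[symmetric] by (simp only: vec.scale_scale)
      finally show False using x(2) by blast
    qed
    ultimately show ?thesis
      using that p(1) by simp
  qed
  let ?L = "\<lambda>(t, \<alpha>, \<beta>, \<xi>, \<eta>). t *s p + \<alpha> *s s + \<beta> *s u + \<xi> *s x + \<eta> *s y"
  have "inj ?L"
  proof (rule injI)
    fix a b assume ab: "?L a = ?L b"
    obtain t \<alpha> \<beta> \<xi> \<eta> where a: "a = (t, \<alpha>, \<beta>, \<xi>, \<eta>)"
      by (rule prod_cases5)
    obtain t' \<alpha>' \<beta>' \<xi>' \<eta>' where b: "b = (t', \<alpha>', \<beta>', \<xi>', \<eta>')"
      by (rule prod_cases5)
    have eq: "t *s p + \<alpha> *s s + \<beta> *s u + \<xi> *s x + \<eta> *s y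
      = t' *s p + \<alpha>' *s s + \<beta>' *s u + \<xi>' *s x + \<eta>' *s y"
      using ab by (simp add: a b)
    have "\<beta> = \<beta>'"
      using arg_cong[OF eq, of "polar Q s"] by simp
    moreover have "\<alpha> = \<alpha>'"
      using arg_cong[OF eq, of "polar Q u"] by simp
    moreover have "(t - t') *s p + (\<xi> - \<xi>') *s x + (\<eta> - \<eta>') *s y = 0"
      using eq calculation by (simp add: vec_eq_iff algebra_simps)
    from pxy[OF this] have "t = t'" "\<xi> = \<xi>'" "\<eta> = \<eta>'" by simp_all
    ultimately show "a = b"
      by (simp add: a b)
  qed
  \<comment> \<open>Coordinates and vectors both number q^5, so injectivity gives
    surjectivity.\<close>
  then have "card (range ?L) = CARD('a ^ 5)"
    by (simp add: card_image eval_nat_numeral)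
  then have "range ?L = UNIV"
    by (intro card_subset_eq) simp_all
  with \<open>inj ?L\<close> have bij: "bij ?L"
    by (simp add: bij_betw_def)
  have aniso: "\<xi> = 0 \<and> \<eta> = 0" if z0: "Q (\<xi> *s x + \<eta> *s y) = 0" for \<xi> \<eta>
  proof (rule ccontr)
    assume nz: "\<not> ?thesis"
    let ?z = "\<xi> *s x + \<eta> *s y"
    have span3: "w \<in> vec.span {?z, u, p} \<longleftrightarrow> (\<exists>k j i. w = k *s ?z + j *s u + i *s p)" for w
      by (auto simp: vec.span_breakdown_eq span_singleton_iff algebra_simps)
    have "?z \<notin> vec.span {u, p}"
    proof
      assume "?z \<in> vec.span {u, p}"
      then obtain j i where "?z = j *s u + i *s p"
        by (auto simp: vec.span_breakdown_eq span_singleton_iff algebra_simps)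
      then have "?L (0, 0, 0, \<xi>, \<eta>) = ?L (i, 0, j, 0, 0)"
        by (simp add: add.commute)
      from injD[OF \<open>inj ?L\<close> this] nz show False by simp
    qed
    then have "vec.independent {?z, u, p}" and "?z \<noteq> u" "?z \<noteq> p"
      using u(1) p(1) vec.span_base[of _ "{u, p}"]
      by (auto simp: vec.independent_insert)
    moreover have "u \<noteq> p"
      using u(1) vec.span_base[of p "{p}"] by auto
    ultimately have "vec.independent {?z, u, p}" and "card {?z, u, p} = 3"
      by simp_all
    then have "vec.dim (vec.span {?z, u, p}) = 3"
      by (metis vec.dim_span_eq_card_independent)
    moreover have "Q w = 0" if "w \<in> vec.span {?z, u, p}" for w
    proof -
      obtain k j i where w: "w = k *s ?z + j *s u + i *s p"
        using \<open>w \<in> _\<close> span3 by blast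
      have "Q (k *s z + j *s u + i *s p) = 0" if "Q z = 0" "polar Q z u = 0" for z
        using that u(2) p(2) by (simp add: polar_add_expand[of Q])
      from this[OF z0] show ?thesis
        unfolding w by simp
    qed
    ultimately show False
      using index[of "vec.span {?z, u, p}"] by simp
  qed
  have "cone_frame Q p s u x y"
  proof (rule cone_frame.intro)
    show "polar Q p v = 0" for v by (rule p(3))
    show "\<xi> = 0 \<and> \<eta> = 0" if "Q (\<xi> *s x + \<eta> *s y) = 0" for \<xi> \<eta>
      using that by (rule aniso)
  qed (fact quadratic p(2) Q_s u(2) su ortho bij)+
  then show ?thesis by blast
qed

section \<open>Points of projective space\<close>

lemma span_singleton_eqD:
  assumes "vec.span {v :: 'a::field ^ 'n} = vec.span {w}"
  shows "\<exists>c. w = c *s v"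
  using assms vec.span_base[of w "{w}"] by (simp add: span_singleton_iff flip: assms)

lemma points_of_iff:
  "P \<in> points_of W \<longleftrightarrow> (\<exists>v. v \<noteq> 0 \<and> P = vec.span {v} \<and> P \<subseteq> W)"
proof
  assume P: "P \<in> points_of W"
  obtain B where B: "B \<subseteq> P" "vec.independent B" "P \<subseteq> vec.span B" "card B = vec.dim P"
    by (rule vec.basis_exists)
  then obtain v where v: "B = {v}"
    using P by (auto simp: points_of_def card_1_singleton_iff)
  have "vec.span B \<subseteq> P"
    using P B(1) by (intro vec.span_minimal) (auto simp: points_of_def)
  with B v P show "\<exists>v. v \<noteq> 0 \<and> P = vec.span {v} \<and> P \<subseteq> W"
    by (auto simp: points_of_def)
next
  assume "\<exists>v. v \<noteq> 0 \<and> P = vec.span {v} \<and> P \<subseteq> W"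
  then show "P \<in> points_of W"
    by (auto simp: points_of_def vec.dim_span_eq_card_independent)
qed

text \<open>By homogeneity one representative decides for the whole point.\<close>

lemma span_in_zero_set_iff:
  assumes "f \<in> quadratic_forms" "v \<noteq> 0"
  shows "vec.span {v} \<in> zero_set f \<longleftrightarrow> eval_poly f v = 0"
proof
  assume "vec.span {v} \<in> zero_set f"
  with \<open>v \<noteq> 0\<close> show "eval_poly f v = 0"
    using vec.span_base[of v "{v}"] by (auto simp: zero_set_def)
next
  assume "eval_poly f v = 0"
  then have "eval_poly f (c *s v) = 0" for c
    by (simp add: quadratic_map_scale[OF quadratic_map_eval_poly[OF assms(1)]])
  with \<open>v \<noteq> 0\<close> show "vec.span {v} \<in> zero_set f"
    by (auto simp: zero_set_def points_of_iff span_singleton_iff)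
qed

section \<open>Normal form of the cone and representatives of its points\<close>

context cone_frame
begin

definition comb :: "'a \<Rightarrow> 'a \<Rightarrow> 'a \<Rightarrow> 'a \<Rightarrow> 'a \<Rightarrow> 'a ^ 5"
  where "comb t \<alpha> \<beta> \<xi> \<eta> = t *s p + \<alpha> *s s + \<beta> *s u + \<xi> *s x + \<eta> *s y"

lemma comb_inject [simp]:
  "comb t \<alpha> \<beta> \<xi> \<eta> = comb t' \<alpha>' \<beta>' \<xi>' \<eta>' \<longleftrightarrow> t = t' \<and> \<alpha> = \<alpha>' \<and> \<beta> = \<beta>' \<and> \<xi> = \<xi>' \<and> \<eta> = \<eta>'"
  using injD[OF bij_is_inj[OF frame_bij], of "(t, \<alpha>, \<beta>, \<xi>, \<eta>)" "(t', \<alpha>', \<beta>', \<xi>', \<eta>')"]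
  unfolding comb_def by auto

lemma comb_cases: obtains t \<alpha> \<beta> \<xi> \<eta> where "v = comb t \<alpha> \<beta> \<xi> \<eta>"
  using bij_is_surj[OF frame_bij] surjD[of _ v] that unfolding comb_def by fastforce

lemma comb_scale: "c *s comb t \<alpha> \<beta> \<xi> \<eta> = comb (c * t) (c * \<alpha>) (c * \<beta>) (c * \<xi>) (c * \<eta>)"
  by (simp add: comb_def vec.scale_right_distrib)

lemma comb_eq_0_iff [simp]: "comb t \<alpha> \<beta> \<xi> \<eta> = 0 \<longleftrightarrow> t = 0 \<and> \<alpha> = 0 \<and> \<beta> = 0 \<and> \<xi> = 0 \<and> \<eta> = 0"
  using comb_inject[of t \<alpha> \<beta> \<xi> \<eta> 0 0 0 0 0] by (simp add: comb_def del: comb_inject)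

lemma quadratic_map_comb:
  assumes "quadratic_map R"
  shows "R (comb t \<alpha> \<beta> \<xi> \<eta>) = t\<^sup>2 * R p + \<alpha>\<^sup>2 * R s + \<beta>\<^sup>2 * R u + \<xi>\<^sup>2 * R x + \<eta>\<^sup>2 * R y
    + t * \<alpha> * polar R p s + t * \<beta> * polar R p u + t * \<xi> * polar R p x + t * \<eta> * polar R p y
    + \<alpha> * \<beta> * polar R s u + \<alpha> * \<xi> * polar R s x + \<alpha> * \<eta> * polar R s y
    + \<beta> * \<xi> * polar R u x + \<beta> * \<eta> * polar R u y + \<xi> * \<eta> * polar R x y"
  unfolding comb_def polar_add_expand[of R] quadratic_map_simps[OF assms] distrib_left
  by (simp add: mult_ac add_ac)

text \<open>The form \<open>Q (\<xi> *s x + \<eta> *s y)\<close>, written out as a polynomial in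
  \<xi> and \<eta>.\<close>

definition aniso :: "'a \<Rightarrow> 'a \<Rightarrow> 'a"
  where "aniso \<xi> \<eta> = \<xi>\<^sup>2 * Q x + \<xi> * \<eta> * polar Q x y + \<eta>\<^sup>2 * Q y"

lemma aniso_eq_0D: "aniso \<xi> \<eta> = 0 \<Longrightarrow> \<xi> = 0 \<and> \<eta> = 0"
  using anisotropic[of \<xi> \<eta>] polar_commute[of Q y x]
  by (simp add: aniso_def polar_add_expand[of Q] quadratic_map_simps[OF quadratic] mult_ac add_ac)

lemma Q_x_nonzero: "Q x \<noteq> 0" and Q_y_nonzero: "Q y \<noteq> 0"
  using aniso_eq_0D[of 1 0] aniso_eq_0D[of 0 1] by (auto simp: aniso_def)

lemma Q_comb: "Q (comb t \<alpha> \<beta> \<xi> \<eta>) = \<alpha> * \<beta> + aniso \<xi> \<eta>"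
  unfolding quadratic_map_comb[OF quadratic] aniso_def
  by (simp add: Q_p Q_s Q_u polar_p polar_s_u polar_s_x polar_s_y polar_u_x polar_u_y)

definition ruling_point :: "'a \<Rightarrow> 'a ^ 5"
  where "ruling_point t = comb t 0 1 0 0"

text \<open>With the coordinate \<alpha> normalised to 1, the equation of the cone determines
  \<beta>.\<close>

definition affine_point :: "('a \<times> 'a) \<times> 'a \<Rightarrow> 'a ^ 5"
  where "affine_point = (\<lambda>((\<xi>, \<eta>), t). comb t 1 (- aniso \<xi> \<eta>) \<xi> \<eta>)"

text \<open>One representative for each point of the cone: the vertex, the rest of the line through the
  vertex and \<open>u\<close>, and the points off the tangent hyperplane of \<open>u\<close>.\<close>

definition reps :: "('a ^ 5) set"
  where "reps = insert (comb 1 0 0 0 0) (range ruling_point \<union> range affine_point)"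

lemma reps_singular: "v \<in> reps \<Longrightarrow> Q v = 0"
  by (auto simp: reps_def ruling_point_def affine_point_def Q_comb aniso_def)

lemma reps_nonzero: "v \<in> reps \<Longrightarrow> v \<noteq> 0"
  by (auto simp: reps_def ruling_point_def affine_point_def)

text \<open>The first nonzero coordinate in the order \<alpha>, \<beta>, \<open>t\<close> is 1 in
  each representative, so different representatives give different points.\<close>

lemma reps_scale_eq: "v \<in> reps \<Longrightarrow> c *s v \<in> reps \<Longrightarrow> c *s v = v"
  by (auto simp: reps_def ruling_point_def affine_point_def comb_scale)

text \<open>If \<alpha> is nonzero, divide by it. Otherwise the equation reduces to
  \<open>aniso \<xi> \<eta> = 0\<close>, which kills \<xi> and \<eta> and leaves only the ruling
  through \<open>u\<close>.\<close>

lemma singular_is_scaled_rep: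
  assumes "Q v = 0" "v \<noteq> 0"
  shows "\<exists>c w. c \<noteq> 0 \<and> w \<in> reps \<and> v = c *s w"
proof -
  obtain t \<alpha> \<beta> \<xi> \<eta> where v: "v = comb t \<alpha> \<beta> \<xi> \<eta>"
    by (rule comb_cases)
  consider "\<alpha> \<noteq> 0" | "\<alpha> = 0" "\<beta> \<noteq> 0" | "\<alpha> = 0" "\<beta> = 0"
    by blast
  then show ?thesis
  proof cases
    case 1
    let ?w = "affine_point ((\<xi> / \<alpha>, \<eta> / \<alpha>), t / \<alpha>)"
    have "aniso (\<xi> / \<alpha>) (\<eta> / \<alpha>) = aniso \<xi> \<eta> / \<alpha>\<^sup>2"
      by (simp add: aniso_def add_divide_distrib power_divide power2_eq_square)
    also have "aniso \<xi> \<eta> = - (\<alpha> * \<beta>)"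
      using assms(1) unfolding v Q_comb by (simp add: eq_neg_iff_add_eq_0 add.commute)
    finally have "v = \<alpha> *s ?w"
      using 1 by (simp add: v affine_point_def comb_scale power2_eq_square)
    with 1 show ?thesis
      unfolding reps_def by blast
  next
    case 2
    then have "aniso \<xi> \<eta> = 0"
      using assms(1) unfolding v Q_comb by simp
    then have "\<xi> = 0" "\<eta> = 0"
      using aniso_eq_0D[of \<xi> \<eta>] by simp_all
    with 2 have "v = \<beta> *s ruling_point (t / \<beta>)"
      by (simp add: v ruling_point_def comb_scale)
    with 2 show ?thesis
      unfolding reps_def by blast
  next
    case 3
    then have "aniso \<xi> \<eta> = 0"
      using assms(1) unfolding v Q_comb by simp
    then have "\<xi> = 0" "\<eta> = 0"
      using aniso_eq_0D[of \<xi> \<eta>] by simp_all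
    with 3 have "v = t *s comb 1 0 0 0 0"
      by (simp add: v comb_scale)
    moreover from this have "t \<noteq> 0"
      using assms(2) by auto
    ultimately show ?thesis
      unfolding reps_def by blast
  qed
qed

lemma card_reps: "card reps = CARD('a) ^ 3 + CARD('a) + 1"
proof -
  have "inj ruling_point" "inj affine_point"
    by (auto simp: inj_def ruling_point_def affine_point_def)
  then have "card (range ruling_point) = CARD('a)" "card (range affine_point) = CARD('a) ^ 3"
    by (simp_all add: card_image power3_eq_cube)
  moreover have "range ruling_point \<inter> range affine_point = {}"
    and "comb 1 0 0 0 0 \<notin> range ruling_point \<union> range affine_point"
    by (auto simp: ruling_point_def affine_point_def)
  ultimately show ?thesis
    unfolding reps_def by (simp add: card_Un_disjoint)
qed

lemma bij_betw_points:
  fixes f g :: "('a, 5) polynomial"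
  assumes f: "f \<in> quadratic_forms" "eval_poly f = Q" and g: "g \<in> quadratic_forms"
  shows "bij_betw (\<lambda>v. vec.span {v}) {v \<in> reps. eval_poly g v = 0} (zero_set f \<inter> zero_set g)"
  unfolding bij_betw_def
proof
  show "inj_on (\<lambda>v. vec.span {v}) {v \<in> reps. eval_poly g v = 0}"
  proof (rule inj_onI)
    fix v w assume "v \<in> {v \<in> reps. eval_poly g v = 0}" "w \<in> {v \<in> reps. eval_poly g v = 0}"
      and "vec.span {v} = vec.span {w}"
    moreover then obtain c where "w = c *s v"
      using span_singleton_eqD by blast
    ultimately show "v = w"
      using reps_scale_eq[of v c] by auto
  qed
  show "(\<lambda>v. vec.span {v}) ` {v \<in> reps. eval_poly g v = 0} = zero_set f \<inter> zero_set g"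
  proof (intro equalityI subsetI)
    fix P assume "P \<in> (\<lambda>v. vec.span {v}) ` {v \<in> reps. eval_poly g v = 0}"
    then show "P \<in> zero_set f \<inter> zero_set g"
      using span_in_zero_set_iff f g reps_nonzero reps_singular by auto
  next
    fix P assume P: "P \<in> zero_set f \<inter> zero_set g"
    then obtain v where v: "v \<noteq> 0" "P = vec.span {v}"
      by (auto simp: zero_set_def points_of_iff)
    then have "Q v = 0"
      using P f span_in_zero_set_iff[OF f(1)] by auto
    with v obtain c w where w: "c \<noteq> 0" "w \<in> reps" "v = c *s w"
      using singular_is_scaled_rep by blast
    have "P = vec.span {w}"
      unfolding v(2) w(3) vec.span_singleton using w(1)
      by (auto simp: image_iff) (metis nonzero_mult_div_cancel_right times_divide_eq_left)
    moreover from this have "eval_poly g w = 0"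
      using P g span_in_zero_set_iff reps_nonzero w(2) by blast
    ultimately show "P \<in> (\<lambda>v. vec.span {v}) ` {v \<in> reps. eval_poly g v = 0}"
      using w(2) by blast
  qed
qed

lemma card_zero_set_inter:
  fixes f g :: "('a, 5) polynomial"
  assumes "f \<in> quadratic_forms" "eval_poly f = Q" "g \<in> quadratic_forms"
  shows "card (zero_set f \<inter> zero_set g) = card {v \<in> reps. eval_poly g v = 0}"
  using bij_betw_same_card[OF bij_betw_points[OF assms]] by simp

lemma card_zero_set:
  fixes f :: "('a, 5) polynomial"
  assumes "f \<in> quadratic_forms" "eval_poly f = Q"
  shows "card (zero_set f) = CARD('a) ^ 3 + CARD('a) + 1"
proof -
  have "{v \<in> reps. eval_poly f v = 0} = reps"
    using assms reps_singular by auto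
  then show ?thesis
    \<comment> \<open>Intersecting the cone with itself reduces its size to the number of
      representatives.\<close>
    using card_zero_set_inter[OF assms assms(1)] card_reps by simp
qed

text \<open>The product \<alpha>\<beta> has coefficient 1 in \<open>Q\<close>, so
  \<open>polar R s u\<close> is the only possible factor; the hypotheses compare all the other
  coefficients.\<close>

lemma multiple_of_Q:
  assumes R: "quadratic_map R"
    and "R p = 0" "R s = 0" "R u = 0" "R x = polar R s u * Q x" "R y = polar R s u * Q y"
    and "polar R p s = 0" "polar R p u = 0" "polar R p x = 0" "polar R p y = 0"
    and "polar R s x = 0" "polar R s y = 0" "polar R u x = 0" "polar R u y = 0"
    and "polar R x y = polar R s u * polar Q x y"
  shows "R v = polar R s u * Q v"
proof -
  obtain t \<alpha> \<beta> \<xi> \<eta> where v: "v = comb t \<alpha> \<beta> \<xi> \<eta>"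
    by (rule comb_cases)
  show ?thesis
    unfolding v Q_comb quadratic_map_comb[OF R] aniso_def
    using assms by (simp add: algebra_simps)
qed

text \<open>On affine points \<beta> is minus the anisotropic form, so the \<beta>-square term would
  have degree 4; \<open>R u = 0\<close> removes it and leaves total degree at most 3.\<close>

lemma card_reps_zeros_le:
  assumes R: "quadratic_map R" and "R u = 0" and nonmultiple: "\<nexists>c. \<forall>v. R v = c * Q v"
  shows "card {v \<in> reps. R v = 0} \<le> 3 * CARD('a)\<^sup>2 + CARD('a) + 1"
proof -
  \<comment> \<open>\<open>l\<close> and \<open>r\<close> collect the coefficients of
    \<open>t\<close> and of 1; outer positions are powers of \<xi>, inner positions powers of
    \<eta>.\<close>
  define l where "l = [: [:polar R p s, polar R p y, - (Q y * polar R p u):],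
    [:polar R p x, - (polar Q x y * polar R p u):], [:- (Q x * polar R p u):] :]"
  define r where "r = [: [:R s, polar R s y, R y - Q y * polar R s u, - (Q y * polar R u y):],
    [:polar R s x, polar R x y - polar Q x y * polar R s u,
      - (Q y * polar R u x + polar Q x y * polar R u y):],
    [:R x - Q x * polar R s u, - (Q x * polar R u y + polar Q x y * polar R u x):],
    [:- (Q x * polar R u x):] :]"
  have eval: "R (affine_point ((\<xi>, \<eta>), t)) =
      R p * t\<^sup>2 + t * poly (poly l [:\<xi>:]) \<eta> + poly (poly r [:\<xi>:]) \<eta>" for \<xi> \<eta> t
    unfolding affine_point_def prod.case quadratic_map_comb[OF R] l_def r_def aniso_def
    using \<open>R u = 0\<close> by simp (simp add: algebra_simps power2_eq_square)
  have "R p \<noteq> 0 \<or> l \<noteq> 0 \<or> r \<noteq> 0"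
  proof (rule ccontr)
    assume "\<not> ?thesis"
    then have 0: "R p = 0" "l = 0" "r = 0" by simp_all
    \<comment> \<open>\<open>Q x\<close> and \<open>Q y\<close> are nonzero, so the top coefficients
      of \<open>l\<close> and \<open>r\<close> give these three; the remaining coefficients are then
      the hypotheses of \<open>multiple_of_Q\<close>.\<close>
    have "polar R p u = 0" "polar R u x = 0" "polar R u y = 0"
      using 0 Q_x_nonzero Q_y_nonzero by (simp_all add: l_def r_def)
    then have "R v = polar R s u * Q v" for v
      using 0 \<open>R u = 0\<close> by - (rule multiple_of_Q[OF R]; simp add: l_def r_def)
    with nonmultiple show False by blast
  qed
  moreover have "total_degree_le l 2"
    unfolding l_def numeral_2_eq_2
    by (intro total_degree_le_pCons total_degree_le_singleton) (simp_all add: degree_pCons_eq_if)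
  moreover have "total_degree_le r 3"
    unfolding r_def numeral_3_eq_3
    by (intro total_degree_le_pCons total_degree_le_singleton) (simp_all add: degree_pCons_eq_if)
  ultimately have "card {((\<xi>, \<eta>), t). R p * t\<^sup>2 + t * poly (poly l [:\<xi>:]) \<eta> + poly (poly r [:\<xi>:]) \<eta> = 0}
      \<le> 3 * CARD('a)\<^sup>2"
    by (rule card_zeros_quadratic_family_le)
  also have "{((\<xi>, \<eta>), t). R p * t\<^sup>2 + t * poly (poly l [:\<xi>:]) \<eta> + poly (poly r [:\<xi>:]) \<eta> = 0}
      = {b. R (affine_point b) = 0}"
    using eval by auto
  finally have affine: "card (affine_point ` {b. R (affine_point b) = 0}) \<le> 3 * CARD('a)\<^sup>2"
    by (meson card_image_le finite le_trans)
  \<comment> \<open>The vertex and the whole ruling are counted, whether or not \<open>R\<close>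
    vanishes there.\<close>
  have "{v \<in> reps. R v = 0} \<subseteq> insert (comb 1 0 0 0 0) (range ruling_point \<union> affine_point ` {b. R (affine_point b) = 0})"
    by (auto simp: reps_def)
  then have "card {v \<in> reps. R v = 0} \<le>
      card (insert (comb 1 0 0 0 0) (range ruling_point \<union> affine_point ` {b. R (affine_point b) = 0}))"
    by (rule card_mono[rotated]) simp
  also have "\<dots> \<le> 1 + card (range ruling_point \<union> affine_point ` {b. R (affine_point b) = 0})"
    by (simp add: card_insert_if)
  also have "\<dots> \<le> 1 + (card (range ruling_point) + card (affine_point ` {b. R (affine_point b) = 0}))"
    by (simp add: card_Un_le)
  also have "card (range ruling_point) \<le> CARD('a)"
    by (simp add: card_image_le)
  finally show ?thesis
    using affine by simp
qed

end

section \<open>Forms vanishing on the cone over the field with three elements\<close>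

lemma three_eq_zero_if_CARD_3:
  assumes "CARD('a::{field, finite}) = 3"
  shows "(3 :: 'a) = 0"
proof -
  have "{0, 1 :: 'a} \<noteq> UNIV"
    using assms by (metis card_2_iff numeral_eq_iff semiring_norm(89) zero_neq_one)
  then obtain w :: 'a where w: "w \<noteq> 0" "w \<noteq> 1"
    by auto
  then have "card {0, 1, w} = 3" by simp
  then have UNIV: "{0, 1, w} = UNIV"
    using assms by (intro card_subset_eq) simp_all
  \<comment> \<open>Adding 1 to \<open>w\<close> can only give 0, and then 1 + 1 can only be
    \<open>w\<close>.\<close>
  have "w + 1 \<in> {0, 1, w}" unfolding UNIV by simp
  then have w1: "w = - 1"
    using w by (auto simp: eq_neg_iff_add_eq_0)
  have "1 + 1 \<in> {0, 1, w}" unfolding UNIV by simp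
  moreover have "(1 :: 'a) + 1 \<noteq> 0"
    using w(2) w1 by (metis eq_neg_iff_add_eq_0)
  moreover have "(1 :: 'a) + 1 \<noteq> 1"
    by (metis add_cancel_left_right zero_neq_one)
  ultimately have "(1 :: 'a) + 1 = - 1"
    using w1 by simp
  then show ?thesis
    by (simp add: eq_neg_iff_add_eq_0)
qed

context cone_frame
begin

text \<open>The reduction of the cubic \<open>r\<close> in \<open>card_reps_zeros_le\<close> modulo \<open>\<xi>\<^sup>3 - \<xi>\<close> and
  \<open>\<eta>\<^sup>3 - \<eta>\<close> can only vanish with \<open>r\<close> itself, because the anisotropic form takes at
  \<open>(polar Q x y, Q x)\<close> the value \<open>Q x * (Q x * Q y - (polar Q x y)\<^sup>2)\<close> in characteristic 3.\<close>

lemma multiple_if_vanishes_on_cone_CARD_3: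
  assumes R: "quadratic_map R" and card: "CARD('a) = 3" and vanish: "\<And>v. v \<in> reps \<Longrightarrow> R v = 0"
  shows "\<exists>c. \<forall>v. R v = c * Q v"
proof -
  have three: "(3 :: 'a) = 0"
    by (rule three_eq_zero_if_CARD_3[OF card])
  then have two: "(2 :: 'a) = - 1"
    by (simp add: eq_neg_iff_add_eq_0)
  have cancel: "k = 0" if "2 * k = 0" for k :: 'a
    using that unfolding two by simp
  note R_comb = quadratic_map_comb[OF R]
  have p: "R p = 0"
    using vanish[of "comb 1 0 0 0 0"] by (simp add: reps_def R_comb)
  have ruling: "R (comb t 0 1 0 0) = 0" for t
    using vanish[of "ruling_point t"] by (simp add: reps_def ruling_point_def)
  have aff: "R (comb t 1 (- aniso \<xi> \<eta>) \<xi> \<eta>) = 0" for t \<xi> \<eta>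
  proof -
    have "affine_point ((\<xi>, \<eta>), t) \<in> reps"
      unfolding reps_def by blast
    from vanish[OF this] show ?thesis
      by (simp add: affine_point_def)
  qed
  have u: "R u = 0"
    using ruling[of 0] by (simp add: R_comb)
  have pu: "polar R p u = 0"
    using ruling[of 1] by (simp add: R_comb p u)
  have s: "R s = 0"
    using aff[of 0 0 0] by (simp add: R_comb aniso_def)
  have ps: "polar R p s = 0"
    using aff[of 1 0 0] by (simp add: R_comb aniso_def p s)
  \<comment> \<open>Subtracting the equations for \<open>t = 1\<close> and \<open>t = 0\<close>
    isolates the mixed term with \<open>p\<close>.\<close>
  have px: "polar R p x = 0"
    using aff[of 1 1 0] aff[of 0 1 0] by (simp add: R_comb p pu ps) algebra
  have py: "polar R p y = 0"
    using aff[of 1 0 1] aff[of 0 0 1] by (simp add: R_comb p pu ps) algebra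
  define a b c d e g where names: "a = Q x" "b = polar Q x y" "c = Q y"
    "d = polar R u x" "e = polar R u y" "g = polar R s u"
  \<comment> \<open>The case \<open>t = 0\<close>: the terms with \<beta> go to the right, where
    \<beta> contributes the anisotropic form as a factor.\<close>
  have eq: "\<xi>\<^sup>2 * R x + \<eta>\<^sup>2 * R y + \<xi> * polar R s x + \<eta> * polar R s y + \<xi> * \<eta> * polar R x y
      = (\<xi>\<^sup>2 * a + \<xi> * \<eta> * b + \<eta>\<^sup>2 * c) * (g + \<xi> * d + \<eta> * e)" for \<xi> \<eta>
    using aff[of 0 \<xi> \<eta>] by (simp add: R_comb s u aniso_def names) (simp add: algebra_simps)
  \<comment> \<open>Adding the equations at opposite arguments leaves the even part; the odd part
    then yields \<open>sx\<close> and \<open>sy\<close>, since cubes of 1 and -1 equal their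
    arguments.\<close>
  have "2 * (R x - g * a) = 0"
    using eq[of 1 0] eq[of "- 1" 0] by simp algebra
  from cancel[OF this] have x: "R x = g * a" by simp
  have "2 * (R y - g * c) = 0"
    using eq[of 0 1] eq[of 0 "- 1"] by simp algebra
  from cancel[OF this] have y: "R y = g * c" by simp
  have sx: "polar R s x = a * d"
    using eq[of 1 0] x by simp algebra
  have sy: "polar R s y = c * e"
    using eq[of 0 1] y by simp algebra
  have "2 * (polar R x y - g * b) = 0"
    using eq[of 1 1] eq[of "- 1" "- 1"] x y by simp algebra
  from cancel[OF this] have xy: "polar R x y = g * b" by simp
  \<comment> \<open>What remains are the coefficients of the two mixed cubic monomials, seen through
    their sum and their difference.\<close>
  have 1: "(a * e + b * d) + (b * e + c * d) = 0"
    using eq[of 1 1] x y xy sx sy by simp algebra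
  have 2: "(a * e + b * d) - (b * e + c * d) = 0"
    using eq[of 1 "- 1"] x y xy sx sy by simp algebra
  have ae: "a * e + b * d = 0" and cd: "b * e + c * d = 0"
    by (rule cancel; use 1 2 in algebra)+
  have "aniso b a = a * (3 * b\<^sup>2 + (a * c - b\<^sup>2))"
    by (simp add: aniso_def flip: names) algebra
  then have "aniso b a = a * (a * c - b\<^sup>2)"
    by (simp add: three)
  moreover have "a \<noteq> 0"
    using Q_x_nonzero by (simp add: names)
  ultimately have disc: "a * c - b\<^sup>2 \<noteq> 0"
    using aniso_eq_0D[of b a] by auto
  \<comment> \<open>\<open>ae\<close> and \<open>cd\<close> form a linear system for
    \<open>e\<close> and \<open>d\<close> with determinant \<open>a * c - b\<^sup>2\<close>.\<close>
  have "e * (a * c - b\<^sup>2) = 0" "d * (a * c - b\<^sup>2) = 0"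
    using ae cd by algebra+
  with disc have "e = 0" "d = 0" by simp_all
  then have "R v = polar R s u * Q v" for v
    by (intro multiple_of_Q[OF R, where v = v])
       (use p s u x y pu ps px py sx sy xy in \<open>simp_all add: names\<close>)
  then show ?thesis by blast
qed

end

section \<open>Rank and projective index\<close>

text \<open>A coordinate change attaining the rank leaves one variable \<open>k\<close> out, and its
  column is \<open>p\<close>. A second singular radical vector off the line of \<open>p\<close>
  could serve as another column, giving a form in at most three variables.\<close>

lemma rank_4_radical:
  fixes f :: "('a::field, 5) polynomial"
  assumes f: "f \<in> quadratic_forms" and rank: "form_rank f = 4"
  obtains p where "p \<noteq> 0" "eval_poly f p = 0" "\<And>v. polar (eval_poly f) p v = 0"
    and "\<And>r. eval_poly f r = 0 \<Longrightarrow> (\<And>v. polar (eval_poly f) r v = 0) \<Longrightarrow> r \<in> vec.span {p}"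
proof -
  let ?F = "eval_poly f"
  note quad = quadratic_map_eval_poly[OF f]
  let ?P = "\<lambda>r. \<exists>A. invertible A \<and> r = card (indets (linear_change A f))"
  have "?P (card (indets (linear_change (mat 1) f)))"
    unfolding invertible_def by (metis matrix_mul_lid)
  then have "?P (form_rank f)"
    unfolding form_rank_def by (rule LeastI)
  then obtain A where A: "invertible A" "card (indets (linear_change A f)) = 4"
    using rank by auto
  have "indets (linear_change A f) \<noteq> UNIV"
    using A(2) by (intro notI) simp
  then obtain k where k: "k \<notin> indets (linear_change A f)"
    by blast
  have inj: "v = w" if "A *v v = A *v w" for v w
    using that A(1) by (metis invertible_def matrix_vector_mul_assoc matrix_vector_mul_lid)
  have surj: "\<exists>w. v = A *v w" for v
    using A(1) by (metis invertible_def matrix_vector_mul_assoc matrix_vector_mul_lid)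
  define p where "p = A *v axis k 1"
  have p_indep: "?F (v + t *s p) = ?F v" for v t
  proof -
    obtain w where w: "v = A *v w" using surj by blast
    have "v + t *s p = A *v (w + t *s axis k 1)"
      by (simp add: w p_def matrix_vector_right_distrib vec.scale)
    then show ?thesis
      using eval_poly_independent[OF k, of w t] by (simp add: eval_poly_linear_change w)
  qed
  have F0: "?F 0 = 0"
    by (rule quadratic_map_zero[OF quad])
  have Fp: "?F p = 0"
    using p_indep[of 0 1] F0 by simp
  have polar_p: "polar ?F p v = 0" for v
    using p_indep[of v 1] Fp by (simp add: polar_def add.commute)
  have p0: "p \<noteq> 0"
    using inj[of "axis k 1" 0] by (auto simp: p_def axis_eq_0_iff)
  have "r \<in> vec.span {p}" if r: "?F r = 0" "\<And>v. polar ?F r v = 0" for r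
  proof (rule ccontr)
    assume notin: "r \<notin> vec.span {p}"
    obtain r' where r': "r = A *v r'" using surj by blast
    have "\<exists>j. j \<noteq> k \<and> r' $ j \<noteq> 0"
    proof (rule ccontr)
      assume "\<not> ?thesis"
      then have "r' = r' $ k *s axis k 1"
        by (auto simp: vec_eq_iff axis_def)
      then have "r = r' $ k *s p"
        unfolding r' p_def by (metis vec.scale)
      with notin show False by (auto simp: span_singleton_iff)
    qed
    then obtain j where j: "j \<noteq> k" "r' $ j \<noteq> 0" by blast
    \<comment> \<open>The identity with column \<open>j\<close> replaced by \<open>r'\<close>; it is
      invertible as \<open>r' $ j\<close> is nonzero, and \<open>A ** E\<close> has columns
      \<open>p\<close> at \<open>k\<close> and \<open>r\<close> at \<open>j\<close>.\<close>
    define E :: "'a ^ 5 ^ 5" where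
      "E = (\<chi> i l. if l = j then r' $ i else if i = l then 1 else 0)"
    have E_mult: "(E *v v) $ i = v $ j * r' $ i + (if i = j then 0 else v $ i)" for v i
    proof -
      have "(E *v v) $ i = (\<Sum>l\<in>UNIV. (if l = j then v $ j * r' $ i else 0) +
          (if l = i then if i = j then 0 else v $ i else 0))"
        unfolding matrix_vector_mult_def vec_lambda_beta by (intro sum.cong) (auto simp: E_def)
      then show ?thesis by (simp add: sum.distrib)
    qed
    have "v = 0" if "E *v v = 0" for v
    proof -
      have eq: "v $ j * r' $ i + (if i = j then 0 else v $ i) = 0" for i
        using that by (simp flip: E_mult)
      then have "v $ j = 0"
        using eq[of j] j(2) by simp
      then show ?thesis
        using eq by (simp add: vec_eq_iff) (metis)
    qed
    then have "invertible E"
      by (simp add: invertible_left_inverse matrix_left_invertible_ker)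
    with A(1) have inv: "invertible (A ** E)"
      by (rule invertible_mult)
    have "E *v axis k 1 = axis k 1" "E *v axis j 1 = r'"
      using j(1) by (auto simp: vec_eq_iff E_mult) (auto simp: axis_def)
    then have cols: "(A ** E) *v axis k 1 = p" "(A ** E) *v axis j 1 = r"
      by (simp_all add: p_def r' flip: matrix_vector_mul_assoc)
    let ?g = "linear_change (A ** E) f"
    have g: "?g \<in> quadratic_forms"
      by (rule quadratic_forms_linear_change[OF f])
    have "k \<notin> indets ?g"
      by (rule not_in_indets_if_independent[OF g])
         (simp add: eval_poly_linear_change matrix_vector_right_distrib vec.scale cols p_indep)
    moreover have "?F (v + t *s r) = ?F v" for v t
      using r polar_commute[of ?F r v] polar_add_expand[of ?F v "t *s r"]
      by (simp add: quadratic_map_simps[OF quad])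
    then have "j \<notin> indets ?g"
      by (intro not_in_indets_if_independent[OF g])
         (simp add: eval_poly_linear_change matrix_vector_right_distrib vec.scale cols)
    ultimately have "indets ?g \<subseteq> UNIV - {j, k}"
      by blast
    then have "card (indets ?g) \<le> card (UNIV - {j, k})"
      by (simp add: card_mono)
    also have "\<dots> = 3"
      using j(1) by (simp add: card_Diff_subset)
    finally have "card (indets ?g) \<le> 3" .
    moreover have "form_rank f \<le> card (indets ?g)"
      unfolding form_rank_def using inv by (intro Least_le) blast
    ultimately show False
      using rank by simp
  qed
  with that p0 Fp polar_p show ?thesis by blast
qed

lemma projective_index_1:
  fixes f :: "('a::{field, finite}, 'n::finite) polynomial"
  assumes f: "f \<in> quadratic_forms" and index: "projective_index (zero_set f) = 1"
  shows "\<And>W. vec.subspace W \<Longrightarrow> (\<And>w. w \<in> W \<Longrightarrow> eval_poly f w = 0) \<Longrightarrow> vec.dim W \<le> 2"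
    and "\<exists>W. vec.subspace W \<and> vec.dim W = 2 \<and> (\<forall>w\<in>W. eval_poly f w = 0)"
proof -
  have F0: "eval_poly f 0 = 0"
    by (rule quadratic_map_zero[OF quadratic_map_eval_poly[OF f]])
  have sub_iff: "points_of W \<subseteq> zero_set f \<longleftrightarrow> (\<forall>w\<in>W. eval_poly f w = 0)" if "vec.subspace W" for W
  proof
    assume sub: "points_of W \<subseteq> zero_set f"
    show "\<forall>w\<in>W. eval_poly f w = 0"
    proof
      fix w assume "w \<in> W"
      show "eval_poly f w = 0"
      proof (cases "w = 0")
        case False
        have "vec.span {w} \<subseteq> W"
          using \<open>w \<in> W\<close> that by (intro vec.span_minimal) auto
        with False have "vec.span {w} \<in> points_of W"
          unfolding points_of_iff by blast
        with sub have "vec.span {w} \<in> zero_set f"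
          by blast
        then show ?thesis
          using span_in_zero_set_iff[OF f False] by simp
      qed (simp add: F0)
    qed
  next
    assume "\<forall>w\<in>W. eval_poly f w = 0"
    then show "points_of W \<subseteq> zero_set f"
      by (auto simp: points_of_def zero_set_def)
  qed
  define D where "D = {int (vec.dim W) - 1 | W. vec.subspace W \<and> points_of W \<subseteq> zero_set f}"
  have "finite D"
    unfolding D_def by (rule finite_image_set) simp
  moreover have "Max D = 1"
    using index by (simp add: projective_index_def D_def)
  \<comment> \<open>The zero subspace makes \<open>D\<close> nonempty, so its maximum is
    attained.\<close>
  moreover have "int (vec.dim {0 :: 'a ^ 'n}) - 1 \<in> D"
    unfolding D_def using sub_iff[OF vec.subspace_single_0] F0 vec.subspace_single_0 by blast
  ultimately have le: "\<And>i. i \<in> D \<Longrightarrow> i \<le> 1" and "1 \<in> D"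
    using Max_in[of D] Max_ge[of D] by auto
  show "vec.dim W \<le> 2" if "vec.subspace W" "\<And>w. w \<in> W \<Longrightarrow> eval_poly f w = 0" for W
  proof -
    have "int (vec.dim W) - 1 \<in> D"
      using that sub_iff[OF that(1)] unfolding D_def by blast
    from le[OF this] show ?thesis by simp
  qed
  from \<open>1 \<in> D\<close> obtain W where W: "1 = int (vec.dim W) - 1" "vec.subspace W" "points_of W \<subseteq> zero_set f"
    by (auto simp: D_def)
  then have "vec.dim W = 2" by linarith
  with W sub_iff show "\<exists>W. vec.subspace W \<and> vec.dim W = 2 \<and> (\<forall>w\<in>W. eval_poly f w = 0)"
    by blast
qed

section \<open>Intersections with the cone\<close>

lemma multiple_if_eval_multiple:
  assumes "f \<in> quadratic_forms" "g \<in> quadratic_forms" "\<And>v. eval_poly g v = c * eval_poly f v"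
  shows "g = const_poly c * f"
  by (rule quadratic_form_eqI) (simp_all add: assms quadratic_forms_smult eval_poly_mult)

locale elliptic_cone =
  fixes f :: "('a::{field, finite}, 5) polynomial"
  assumes form: "f \<in> quadratic_forms"
    and rank: "form_rank f = 4"
    and index: "projective_index (zero_set f) = 1"
begin

text \<open>The vertex \<open>p\<close> is fixed while \<open>u\<close> stays free, so that a later
  argument can place \<open>u\<close> on a second quadric. Some \<open>u\<close> exists because a
  totally singular plane does not fit into the line of \<open>p\<close>.\<close>

lemma frames:
  obtains p where
    "\<And>u. u \<notin> vec.span {p} \<Longrightarrow> eval_poly f u = 0 \<Longrightarrow> \<exists>s x y. cone_frame (eval_poly f) p s u x y"
    "\<exists>u. u \<notin> vec.span {p} \<and> eval_poly f u = 0"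
proof -
  obtain p where p: "p \<noteq> 0" "eval_poly f p = 0" "\<And>v. polar (eval_poly f) p v = 0"
    and rad: "\<And>r. eval_poly f r = 0 \<Longrightarrow> (\<And>v. polar (eval_poly f) r v = 0) \<Longrightarrow> r \<in> vec.span {p}"
    using rank_4_radical[OF form rank] by blast
  obtain W where W: "vec.subspace W" "vec.dim W = 2" "\<And>w. w \<in> W \<Longrightarrow> eval_poly f w = 0"
    using projective_index_1(2)[OF form index] by blast
  have "\<not> W \<subseteq> vec.span {p}"
    using vec.dim_le_card[of W "{p}"] W(2) by auto
  then have "\<exists>u. u \<notin> vec.span {p} \<and> eval_poly f u = 0"
    using W(3) by blast
  moreover have "\<exists>s x y. cone_frame (eval_poly f) p s u x y"
    if "u \<notin> vec.span {p}" "eval_poly f u = 0" for u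
    using quadratic_map_eval_poly[OF form] p rad projective_index_1(1)[OF form index] that
    by (rule cone_frame_exists)
  ultimately show ?thesis
    using that by blast
qed

lemma card_cone: "card (zero_set f) = CARD('a) ^ 3 + CARD('a) + 1"
proof -
  obtain p s u x y where "cone_frame (eval_poly f) p s u x y"
    using frames by metis
  then show ?thesis
    by (rule cone_frame.card_zero_set[OF _ form refl])
qed

lemma card_inter_le:
  assumes g: "g \<in> quadratic_forms" and nonmultiple: "\<nexists>c. g = const_poly c * f"
  shows "card (zero_set f \<inter> zero_set g) \<le> 3 * CARD('a)\<^sup>2 + CARD('a) + 1"
proof -
  have nm: "\<nexists>c. \<forall>v. eval_poly g v = c * eval_poly f v"
    using multiple_if_eval_multiple[OF form g] nonmultiple by blast
  obtain p where frame:
    "\<And>u. u \<notin> vec.span {p} \<Longrightarrow> eval_poly f u = 0 \<Longrightarrow> \<exists>s x y. cone_frame (eval_poly f) p s u x y"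
    using frames by metis
  show ?thesis
  proof (cases "\<exists>u. u \<notin> vec.span {p} \<and> eval_poly f u = 0 \<and> eval_poly g u = 0")
    case True
    then obtain u s x y where u: "eval_poly g u = 0" and "cone_frame (eval_poly f) p s u x y"
      using frame by blast
    then interpret cone_frame "eval_poly f" p s u x y
      by simp
    show ?thesis
      using card_reps_zeros_le[OF quadratic_map_eval_poly[OF g] u nm]
      by (simp add: card_zero_set_inter[OF form refl g])
  next
    \<comment> \<open>Now the two quadrics share at most the vertex.\<close>
    case False
    have "zero_set f \<inter> zero_set g \<subseteq> {vec.span {p}}"
    proof
      fix P assume P: "P \<in> zero_set f \<inter> zero_set g"
      then obtain v where v: "v \<noteq> 0" "P = vec.span {v}"
        by (auto simp: zero_set_def points_of_iff)
      then have "eval_poly f v = 0" "eval_poly g v = 0"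
        using P span_in_zero_set_iff[OF form] span_in_zero_set_iff[OF g] by auto
      with False obtain c where c: "v = c *s p"
        by (auto simp: span_singleton_iff)
      with v(1) have "c \<noteq> 0" by auto
      then have "vec.span {c *s p} = vec.span {p}"
        using vec.span_image_scale[of "{p}" "\<lambda>_. c"] by simp
      then show "P \<in> {vec.span {p}}"
        using v c by simp
    qed
    then have "card (zero_set f \<inter> zero_set g) \<le> 1"
      using card_mono[of "{vec.span {p}}"] by simp
    then show ?thesis by simp
  qed
qed

text \<open>Otherwise the intersection bound applies to the whole cone and gives q^3 \<le> 3q^2;
  this leaves only q = 3, which is treated separately.\<close>

lemma vanishing_imp_multiple:
  assumes q: "CARD('a) \<noteq> 2" and g: "g \<in> quadratic_forms" and sub: "zero_set f \<subseteq> zero_set g"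
  shows "\<exists>c. g = const_poly c * f"
proof (rule ccontr)
  assume nonmultiple: "\<nexists>c. g = const_poly c * f"
  have "zero_set f \<inter> zero_set g = zero_set f"
    using sub by blast
  then have "CARD('a) ^ 3 \<le> 3 * CARD('a)\<^sup>2"
    using card_inter_le[OF g nonmultiple] card_cone by simp
  then have "CARD('a) * CARD('a)\<^sup>2 \<le> 3 * CARD('a)\<^sup>2"
    by (simp add: power3_eq_cube power2_eq_square)
  then have "CARD('a) \<le> 3"
    by simp
  moreover have "card {0, 1 :: 'a} \<le> CARD('a)"
    by (rule card_mono) auto
  ultimately have q3: "CARD('a) = 3"
    using q by simp
  obtain p s u x y where "cone_frame (eval_poly f) p s u x y"
    using frames by metis
  then interpret cone_frame "eval_poly f" p s u x y .
  have "eval_poly g v = 0" if "v \<in> reps" for v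
  proof -
    have "vec.span {v} \<in> zero_set g"
      using sub span_in_zero_set_iff[OF form reps_nonzero[OF that]] reps_singular[OF that] by blast
    then show ?thesis
      using span_in_zero_set_iff[OF g reps_nonzero[OF that]] by simp
  qed
  then have "\<exists>c. \<forall>v. eval_poly g v = c * eval_poly f v"
    by (rule multiple_if_vanishes_on_cone_CARD_3[OF quadratic_map_eval_poly[OF g] q3])
  with multiple_if_eval_multiple[OF form g] nonmultiple show False by blast
qed

end

section \<open>The functional code\<close>

lemma point_value_add: "point_value (f + g) P = point_value f P + point_value g P"
  by (simp add: point_value_def Let_def eval_poly_add add_divide_distrib)

lemma point_value_smult: "point_value (const_poly c * f) P = c * point_value f P"
  by (simp add: point_value_def Let_def eval_poly_mult)

text \<open>The chosen representative spans the point, and the divisor is the square of a nonzero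
  coordinate.\<close>

lemma point_value_eq_0_iff:
  fixes f :: "('a::field, 'n::{finite, linorder}) polynomial"
  assumes f: "f \<in> quadratic_forms" and P: "P \<in> points_of UNIV"
  shows "point_value f P = 0 \<longleftrightarrow> P \<in> zero_set f"
proof -
  define v where "v = (SOME v. v \<in> P \<and> v \<noteq> 0)"
  obtain w where w: "w \<noteq> 0" "P = vec.span {w}"
    using P by (auto simp: points_of_iff)
  then have "w \<in> P \<and> w \<noteq> 0"
    using vec.span_base[of w "{w}"] by simp
  then have v: "v \<in> P" "v \<noteq> 0"
    unfolding v_def by (metis (mono_tags, lifting) someI_ex)+
  then obtain c where "v = c *s w" "c \<noteq> 0"
    using w by (auto simp: span_singleton_iff)
  then have "vec.span {v} = P"
    using vec.span_image_scale[of "{w}" "\<lambda>_. c"] w by simp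
  then have zero: "P \<in> zero_set f \<longleftrightarrow> eval_poly f v = 0"
    using span_in_zero_set_iff[OF f v(2)] by simp
  define i where "i = (LEAST i. v $ i \<noteq> 0)"
  have ex: "\<exists>i. v $ i \<noteq> 0"
    using v(2) by (auto simp: vec_eq_iff)
  then have "i = Min {i. v $ i \<noteq> 0}"
    unfolding i_def by (intro Least_Min) auto
  then have "v $ i \<noteq> 0"
    using Min_in[of "{i. v $ i \<noteq> 0}"] ex by auto
  then show ?thesis
    unfolding point_value_def v_def[symmetric] Let_def i_def[symmetric] by (simp add: zero)
qed

lemma codeword_add: "codeword S (f + g) = codeword S f + codeword S g"
  by (auto simp: codeword_def vec_eq_iff point_value_add)

lemma codeword_smult: "codeword S (const_poly c * f) = c *s codeword S f"
  by (auto simp: codeword_def vec_eq_iff point_value_smult)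

lemma hamming_weight_codeword:
  assumes "f \<in> quadratic_forms" "S \<subseteq> points_of UNIV"
  shows "hamming_weight (codeword S f) = card (S - zero_set f)"
proof -
  have "{P. codeword S f $ P \<noteq> 0} = S - zero_set f"
    using point_value_eq_0_iff[OF assms(1)] assms(2) by (auto simp: codeword_def)
  then show ?thesis by (simp add: hamming_weight_def)
qed

lemma codeword_eq_0_iff:
  assumes "f \<in> quadratic_forms" "S \<subseteq> points_of UNIV"
  shows "codeword S f = 0 \<longleftrightarrow> S \<subseteq> zero_set f"
  using point_value_eq_0_iff[OF assms(1)] assms(2) by (auto simp: codeword_def vec_eq_iff)

lemma subspace_functional_code: "vec.subspace (functional_code S)"
proof (rule vec.subspaceI)
  show "0 \<in> functional_code S"
    unfolding functional_code_def
  proof (rule image_eqI)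
    show "0 = codeword S 0"
      using codeword_smult[of S 0 0] by (simp add: const_poly_def)
  qed (simp add: quadratic_forms_def)
next
  fix v w assume "v \<in> functional_code S" "w \<in> functional_code S"
  then show "v + w \<in> functional_code S"
    unfolding functional_code_def by (auto simp flip: codeword_add intro!: imageI quadratic_forms_add)
next
  fix c v assume "v \<in> functional_code S"
  then show "c *s v \<in> functional_code S"
    unfolding functional_code_def by (auto simp flip: codeword_smult intro!: imageI quadratic_forms_smult)
qed

section \<open>Cardinalities of subspaces and of the space of quadratic forms\<close>

lemma card_span_independent:
  fixes B :: "('a::{field, finite} ^ 'n::finite) set"
  assumes "vec.independent B"
  shows "card (vec.span B) = CARD('a) ^ card B"
proof -
  have "finite B" by simp
  then show ?thesis
    using assms
  proof (induction B)
    case (insert b B)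
    then have b: "b \<notin> vec.span B" and IH: "card (vec.span B) = CARD('a) ^ card B"
      by (auto simp: vec.independent_insert)
    let ?\<phi> = "\<lambda>(k, v). k *s b + v"
    have "inj_on ?\<phi> (UNIV \<times> vec.span B)"
    proof (rule inj_onI, clarify)
      fix k v k' v'
      assume v: "v \<in> vec.span B" "v' \<in> vec.span B" and eq: "k *s b + v = k' *s b + v'"
      have *: "(k - k') *s b = v' - v"
        using eq by (simp add: vec.scale_left_diff_distrib diff_eq_eq) (metis add.commute add_diff_cancel_right' add_diff_eq)
      have "k = k'"
      proof (rule ccontr)
        assume "k \<noteq> k'"
        then have "b = (1 / (k - k')) *s ((k - k') *s b)"
          by (simp only: vec.scale_scale) simp
        also have "\<dots> \<in> vec.span B"
          unfolding * using v by (intro vec.span_scale vec.span_diff)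
        finally show False using b by simp
      qed
      with eq show "k = k' \<and> v = v'" by simp
    qed
    moreover have "?\<phi> ` (UNIV \<times> vec.span B) = vec.span (insert b B)"
    proof (intro equalityI subsetI)
      fix w assume "w \<in> ?\<phi> ` (UNIV \<times> vec.span B)"
      then obtain k v where "w = k *s b + v" "v \<in> vec.span B" by auto
      then have "w - k *s b \<in> vec.span B" by simp
      then show "w \<in> vec.span (insert b B)"
        unfolding vec.span_breakdown_eq by blast
    next
      fix w assume "w \<in> vec.span (insert b B)"
      then obtain k where "w - k *s b \<in> vec.span B"
        by (auto simp: vec.span_breakdown_eq)
      then show "w \<in> ?\<phi> ` (UNIV \<times> vec.span B)"
        by (intro image_eqI[where x = "(k, w - k *s b)"]) auto
    qed
    ultimately have "card (vec.span (insert b B)) = card ((UNIV :: 'a set) \<times> vec.span B)"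
      by (metis card_image)
    then show ?case
      using insert.hyps IH by (simp add: card_cartesian_product)
  qed simp
qed

text \<open>This lets the dimension of a code be read off from its number of words.\<close>

lemma card_subspace:
  fixes W :: "('a::{field, finite} ^ 'n::finite) set"
  assumes "vec.subspace W"
  shows "card W = CARD('a) ^ vec.dim W"
proof -
  obtain B where B: "B \<subseteq> W" "vec.independent B" "W \<subseteq> vec.span B" "card B = vec.dim W"
    by (rule vec.basis_exists)
  then have "vec.span B = W"
    using assms vec.span_minimal by blast
  then show ?thesis
    using card_span_independent[OF B(2)] B(4) by simp
qed

lemma quadratic_monoms_eq:
  "{m :: 'n::{finite, linorder} \<Rightarrow>\<^sub>0 nat. monom_degree m = 2}
    = (\<lambda>(i, j). Poly_Mapping.single i 1 + Poly_Mapping.single j 1) ` {(i, j). i \<le> j}"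
proof (intro equalityI subsetI)
  fix m :: "'n \<Rightarrow>\<^sub>0 nat" assume "m \<in> {m. monom_degree m = 2}"
  then obtain i j where "m = Poly_Mapping.single i 1 + Poly_Mapping.single j 1"
    using quadratic_monom_cases[of m] by blast
  then show "m \<in> (\<lambda>(i, j). Poly_Mapping.single i 1 + Poly_Mapping.single j 1) ` {(i, j). i \<le> j}"
    using linear[of i j] add.commute by (auto simp: image_iff)
next
  fix m :: "'n \<Rightarrow>\<^sub>0 nat"
  assume "m \<in> (\<lambda>(i, j). Poly_Mapping.single i 1 + Poly_Mapping.single j 1) ` {(i, j). i \<le> j}"
  then show "m \<in> {m. monom_degree m = 2}"
    by (auto simp: monom_degree_def lookup_add lookup_single when_def sum.distrib)
qed

text \<open>The pairs with \<open>i \<le> j\<close> and their mirror images cover the square and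
  overlap in the diagonal; doubling avoids division.\<close>

lemma card_quadratic_monoms:
  "2 * card {m :: 'n::{finite, linorder} \<Rightarrow>\<^sub>0 nat. monom_degree m = 2} = CARD('n) * (CARD('n) + 1)"
proof -
  let ?U = "{(i :: 'n, j). i \<le> j}" and ?D = "{(i :: 'n, j). j \<le> i}"
  have "inj_on (\<lambda>(i :: 'n, j). Poly_Mapping.single i (1::nat) + Poly_Mapping.single j 1) ?U"
  proof (rule inj_onI, clarify)
    fix i j i' j' :: 'n
    assume le: "i \<le> j" "i' \<le> j'"
      and eq: "Poly_Mapping.single i (1::nat) + Poly_Mapping.single j 1
        = Poly_Mapping.single i' 1 + Poly_Mapping.single j' 1"
    have "keys (Poly_Mapping.single i (1::nat) + Poly_Mapping.single j 1) = {i, j}" for i j :: 'n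
      by (auto simp: in_keys_iff lookup_add lookup_single when_def split: if_splits)
    with eq have "{i, j} = {i', j'}" by metis
    with le show "i = i' \<and> j = j'"
      by (auto simp: doubleton_eq_iff)
  qed
  then have card: "card {m :: 'n \<Rightarrow>\<^sub>0 nat. monom_degree m = 2} = card ?U"
    unfolding quadratic_monoms_eq by (rule card_image)
  have "?D = prod.swap ` ?U" by auto
  then have "card ?D = card ?U" by (simp add: card_image)
  moreover have "card (?U \<union> ?D) + card (?U \<inter> ?D) = card ?U + card ?D"
    by (rule card_Un_Int[symmetric]) auto
  moreover have "?U \<union> ?D = UNIV" by auto
  moreover have "?U \<inter> ?D = range (\<lambda>i. (i, i))" by auto
  moreover have "card (range (\<lambda>i :: 'n. (i, i))) = CARD('n)"
    by (rule card_image) (auto simp: inj_on_def)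
  ultimately show ?thesis by (simp add: card)
qed

lemma card_quadratic_forms:
  "card (quadratic_forms :: ('a::{field, finite}, 'n::{finite, linorder}) polynomial set)
    = CARD('a) ^ card {m :: 'n \<Rightarrow>\<^sub>0 nat. monom_degree m = 2}"
proof -
  let ?M = "{m :: 'n \<Rightarrow>\<^sub>0 nat. monom_degree m = 2}"
  have fin: "finite ?M"
    unfolding quadratic_monoms_eq by simp
  define \<Phi> :: "(('n \<Rightarrow>\<^sub>0 nat) \<Rightarrow> 'a) \<Rightarrow> ('a, 'n) polynomial"
    where "\<Phi> h = (\<Sum>m\<in>?M. Poly_Mapping.single m (h m))" for h
  have lookup_\<Phi>: "lookup (\<Phi> h) m = (if m \<in> ?M then h m else 0)" for h m
    using fin by (simp add: \<Phi>_def lookup_sum lookup_single when_def)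
  have "bij_betw \<Phi> (?M \<rightarrow>\<^sub>E UNIV) quadratic_forms"
    unfolding bij_betw_def
  proof
    show "inj_on \<Phi> (?M \<rightarrow>\<^sub>E UNIV)"
    proof (rule inj_onI)
      fix h h' assume h: "h \<in> ?M \<rightarrow>\<^sub>E UNIV" "h' \<in> ?M \<rightarrow>\<^sub>E UNIV" and eq: "\<Phi> h = \<Phi> h'"
      have "h m = h' m" if "m \<in> ?M" for m
        using arg_cong[OF eq, of "\<lambda>f. lookup f m"] that unfolding lookup_\<Phi> by simp
      with h show "h = h'" by (rule PiE_ext)
    qed
    show "\<Phi> ` (?M \<rightarrow>\<^sub>E UNIV) = quadratic_forms"
    proof (intro equalityI subsetI)
      fix f assume "f \<in> \<Phi> ` (?M \<rightarrow>\<^sub>E UNIV)"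
      then obtain h where "f = \<Phi> h" by blast
      then have "monom_degree m = 2" if "m \<in> keys f" for m
        using that lookup_\<Phi>[of h m] by (simp add: in_keys_iff split: if_splits)
      then show "f \<in> quadratic_forms"
        by (simp add: quadratic_forms_def)
    next
      fix f :: "('a, 'n) polynomial" assume f: "f \<in> quadratic_forms"
      have "f = \<Phi> (restrict (lookup f) ?M)"
        using f by (intro poly_mapping_eqI) (auto simp: lookup_\<Phi> quadratic_forms_def in_keys_iff)
      moreover have "restrict (lookup f) ?M \<in> ?M \<rightarrow>\<^sub>E UNIV"
        by simp
      ultimately show "f \<in> \<Phi> ` (?M \<rightarrow>\<^sub>E UNIV)" by (rule image_eqI)
    qed
  qed
  then have "card (quadratic_forms :: ('a, 'n) polynomial set) = card (?M \<rightarrow>\<^sub>E (UNIV :: 'a set))"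
    by (simp add: bij_betw_same_card)
  then show ?thesis
    using fin by (simp add: card_PiE)
qed

text \<open>The kernel of the coding map is the line of multiples of \<open>f\<close>, so every word
  has exactly q preimages.\<close>

lemma card_functional_code:
  fixes f :: "('a::{field, finite}, 'n::{finite, linorder}) polynomial"
  assumes f: "f \<in> quadratic_forms" "f \<noteq> 0"
    and kernel: "\<And>g. g \<in> quadratic_forms \<Longrightarrow> codeword S g = 0 \<longleftrightarrow> (\<exists>c. g = const_poly c * f)"
  shows "card (quadratic_forms :: ('a, 'n) polynomial set) = CARD('a) * card (functional_code S)"
proof -
  let ?C = "functional_code S" and ?QF = "quadratic_forms :: ('a, 'n) polynomial set"
  \<comment> \<open>An arbitrary choice of preimages; it need not be linear, since only a bijection
    is wanted.\<close>
  define sec where "sec = inv_into ?QF (codeword S)"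
  have sec: "sec w \<in> ?QF" "codeword S (sec w) = w" if "w \<in> ?C" for w
    using that unfolding sec_def functional_code_def by (simp_all add: inv_into_into f_inv_into_f)
  have cw_mult: "codeword S (const_poly c * f) = 0" for c
    using kernel quadratic_forms_smult[OF f(1)] by blast
  have "\<exists>v. eval_poly f v \<noteq> 0"
    using quadratic_form_eqI[of f 0] f by (auto simp: quadratic_forms_def)
  then obtain v where v: "eval_poly f v \<noteq> 0" by blast
  have inj_c: "c = c'" if "const_poly c * f = const_poly c' * f" for c c'
    using arg_cong[OF that, of "\<lambda>g. eval_poly g v"] v by (simp add: eval_poly_mult)
  have "bij_betw (\<lambda>(c, w). sec w + const_poly c * f) (UNIV \<times> ?C) ?QF"
    unfolding bij_betw_def
  proof
    show "inj_on (\<lambda>(c, w). sec w + const_poly c * f) (UNIV \<times> ?C)"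
    proof (rule inj_onI, clarify)
      fix c w c' w' assume w: "w \<in> ?C" "w' \<in> ?C"
        and eq: "sec w + const_poly c * f = sec w' + const_poly c' * f"
      have "w = w'"
        using arg_cong[OF eq, of "codeword S"] w by (simp add: codeword_add cw_mult sec)
      with eq inj_c show "c = c' \<and> w = w'" by simp
    qed
    show "(\<lambda>(c, w). sec w + const_poly c * f) ` (UNIV \<times> ?C) = ?QF"
    proof (intro equalityI subsetI)
      fix g assume "g \<in> (\<lambda>(c, w). sec w + const_poly c * f) ` (UNIV \<times> ?C)"
      then show "g \<in> ?QF"
        using sec f by (auto intro!: quadratic_forms_add quadratic_forms_smult)
    next
      fix g assume g: "g \<in> ?QF"
      then have w: "codeword S g \<in> ?C"
        by (simp add: functional_code_def)
      let ?h = "g - sec (codeword S g)"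
      have "codeword S g = codeword S ?h + codeword S (sec (codeword S g))"
        by (simp flip: codeword_add)
      then have "codeword S ?h = 0"
        using sec(2)[OF w] by simp
      then obtain c where "?h = const_poly c * f"
        using kernel[of ?h] quadratic_forms_diff[OF g sec(1)[OF w]] by blast
      then have "g = sec (codeword S g) + const_poly c * f"
        by (simp add: algebra_simps)
      with w show "g \<in> (\<lambda>(c, w). sec w + const_poly c * f) ` (UNIV \<times> ?C)"
        by (intro image_eqI[where x = "(c, codeword S g)"]) auto
    qed
  qed
  then have "card (UNIV \<times> ?C :: ('a \<times> _) set) = card ?QF"
    by (rule bij_betw_same_card)
  then show ?thesis
    by (simp add: card_cartesian_product)
qed

section \<open>The parameters of the code of the cone\<close>

context elliptic_cone
begin

lemma zero_set_subset_points: "zero_set f \<subseteq> points_of UNIV"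
  by (auto simp: zero_set_def)

text \<open>The square of a coordinate that is nonzero at some point of the cone gives a nonzero
  word, for every q.\<close>

lemma functional_code_nonzero: "functional_code (zero_set f) \<noteq> {0}"
proof -
  have "zero_set f \<noteq> {}"
    using card_cone by auto
  then obtain v where v: "v \<noteq> 0" "vec.span {v} \<in> zero_set f"
    unfolding zero_set_def points_of_iff by blast
  then obtain i where i: "v $ i \<noteq> 0"
    by (auto simp: vec_eq_iff)
  let ?g = "indet i * indet i :: ('a, 5) polynomial"
  have g: "?g \<in> quadratic_forms"
    using homogeneous_mult[OF homogeneous_indet homogeneous_indet, of i i]
    by (simp add: quadratic_forms_eq_homogeneous numeral_2_eq_2)
  have "vec.span {v} \<notin> zero_set ?g"
    using i by (simp add: span_in_zero_set_iff[OF g v(1)] eval_poly_mult)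
  then have "codeword (zero_set f) ?g \<noteq> 0"
    using v(2) codeword_eq_0_iff[OF g zero_set_subset_points] by blast
  then show ?thesis
    using g unfolding functional_code_def by blast
qed

text \<open>There are 15 quadratic monomials in five variables, and the kernel of the coding map
  accounts for one dimension.\<close>

lemma dim_functional_code:
  assumes "CARD('a) \<noteq> 2"
  shows "vec.dim (functional_code (zero_set f)) = 14"
proof -
  let ?C = "functional_code (zero_set f)"
  have f0: "f \<noteq> 0"
  proof
    assume "f = 0"
    then have "indets (linear_change (mat 1) f) = {}"
      by (simp add: indets_def linear_change_def)
    then have "form_rank f \<le> 0"
      unfolding form_rank_def
      by (intro Least_le exI[of _ "mat 1"]) (auto simp: invertible_def intro!: exI[of _ "mat 1"])
    with rank show False by simp
  qed
  have "codeword (zero_set f) g = 0 \<longleftrightarrow> (\<exists>c. g = const_poly c * f)" if g: "g \<in> quadratic_forms" for g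
  proof -
    have "zero_set f \<subseteq> zero_set (const_poly c * f)" for c
      by (auto simp: zero_set_def eval_poly_mult)
    then show ?thesis
      using codeword_eq_0_iff[OF g zero_set_subset_points] vanishing_imp_multiple[OF assms g] by blast
  qed
  from card_functional_code[OF form f0 this]
  have "CARD('a) ^ card {m :: 5 \<Rightarrow>\<^sub>0 nat. monom_degree m = 2} = CARD('a) * card ?C"
    by (simp add: card_quadratic_forms)
  moreover have "card {m :: 5 \<Rightarrow>\<^sub>0 nat. monom_degree m = 2} = 15"
    using card_quadratic_monoms[where 'n = 5] by simp
  ultimately have power: "CARD('a) ^ 15 = CARD('a) ^ Suc (vec.dim ?C)"
    by (simp only: card_subspace[OF subspace_functional_code] power_Suc)
  have "card {0, 1 :: 'a} \<le> CARD('a)"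
    by (rule card_mono) auto
  then have "1 < CARD('a)" by simp
  then have "15 = Suc (vec.dim ?C)"
    using power by (rule power_inject_exp[THEN iffD1])
  then show ?thesis by simp
qed

text \<open>A word of minimum weight comes from a form that is not a multiple of \<open>f\<close>,
  so the intersection bound is subtracted from q^3 + q + 1. Integers are used because the difference
  is negative for q = 2.\<close>

lemma minimum_distance_ge:
  "int (minimum_distance (functional_code (zero_set f))) \<ge> int CARD('a) ^ 3 - 3 * int CARD('a) ^ 2"
proof -
  let ?C = "functional_code (zero_set f)"
  have "0 \<in> ?C"
    using subspace_functional_code by (rule vec.subspace_0)
  then have "?C - {0} \<noteq> {}"
    using functional_code_nonzero by blast
  then have "minimum_distance ?C \<in> hamming_weight ` (?C - {0})"
    unfolding minimum_distance_def by (intro Min_in) auto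
  then obtain g where g: "g \<in> quadratic_forms" "codeword (zero_set f) g \<noteq> 0"
    and "minimum_distance ?C = hamming_weight (codeword (zero_set f) g)"
    unfolding functional_code_def by blast
  then have d: "minimum_distance ?C = card (zero_set f - zero_set g)"
    by (simp add: hamming_weight_codeword zero_set_subset_points)
  have "\<nexists>c. g = const_poly c * f"
    using g codeword_eq_0_iff[OF g(1) zero_set_subset_points]
    by (auto simp: zero_set_def eval_poly_mult)
  then have "card (zero_set f \<inter> zero_set g) \<le> 3 * CARD('a)\<^sup>2 + CARD('a) + 1"
    by (rule card_inter_le[OF g(1)])
  moreover have "card (zero_set f) = card (zero_set f \<inter> zero_set g) + card (zero_set f - zero_set g)"
    by (rule card_Int_Diff) simp
  ultimately have "CARD('a) ^ 3 \<le> minimum_distance ?C + 3 * CARD('a)\<^sup>2"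
    using card_cone d by simp
  then have "int (CARD('a) ^ 3) \<le> int (minimum_distance ?C + 3 * CARD('a)\<^sup>2)"
    by (simp only: of_nat_le_iff)
  then show ?thesis by simp
qed

end

text \<open>For q = 2 the length is 11, so the dimension cannot be 14; that value is therefore
  asserted for all other q.\<close>

theorem theorem4p6:
  fixes fX :: "('a::{field, finite}, 5) polynomial"
    and X :: "('a, 5) point set"
    and q :: nat
  assumes "q = CARD('a)"
    and "fX \<in> quadratic_forms" and "fX \<noteq> 0"
    and "X = zero_set fX"
    and "form_rank fX = 4"
    and "projective_index X = 1"
  shows "(\<forall>f \<in> quadratic_forms. f \<noteq> 0 \<and> (\<nexists>c. f = const_poly c * fX) \<longrightarrow>
            card (X \<inter> zero_set f) \<le> 3 * q^2 + q + 1) \<and>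
         (\<exists>k d. is_linear_code X (functional_code X) (q^3 + q + 1) k d \<and>
            (q \<noteq> 2 \<longrightarrow> k = 14) \<and>
            int d \<ge> int q ^ 3 - 3 * int q ^ 2)"
proof -
  interpret elliptic_cone fX
    using assms by unfold_locales simp_all
  have "functional_code X \<subseteq> words_on X"
    by (auto simp: functional_code_def words_on_def codeword_def)
  then have "is_linear_code X (functional_code X) (q^3 + q + 1)
      (vec.dim (functional_code X)) (minimum_distance (functional_code X))"
    using subspace_functional_code functional_code_nonzero card_cone
    by (simp add: is_linear_code_def assms(1,4))
  moreover have "q \<noteq> 2 \<longrightarrow> vec.dim (functional_code X) = 14"
    using dim_functional_code by (simp add: assms(1,4))
  moreover have "int (minimum_distance (functional_code X)) \<ge> int q ^ 3 - 3 * int q ^ 2"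
    using minimum_distance_ge by (simp add: assms(1,4))
  ultimately show ?thesis
    using card_inter_le unfolding assms(1,4) by blast
qed

end
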